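(* Let $n\ge 2$, let $\mathcal{E}$ be a Hilbert space, and let $\mathcal{S}$ be a submodule of $H^2(\mathbb{D}^n)\otimes\mathcal{E}$. Then $\mathcal{S}$ is a Brehmer submodule of $H^2(\mathbb{D}^n)\otimes\mathcal{E}$ if and only if $\mathcal{S}$ is a doubly commuting submodule.
   Context: All Hilbert spaces are complex. $H^2(\mathbb{D}^n)$ is the Hardy space of the unit polydisc, i.e. the reproducing kernel Hilbert space with kernel $g(\boldsymbol{z},\boldsymbol{w})=\prod_{i=1}^n(1-z_i\bar w_i)^{-1}$, and $M_{z_i}$ is multiplication by $z_i$. $H^2(\mathbb{D}^n)\otimes\mathcal{E}$ is identified with the $\mathcal{E}$-valued Hardy space. A submodule is a closed subspace $\mathcal{S}$ invariant under $M_{z_i}\otimes I_{\mathcal{E}}$ for $i=1,\dots,n$; put $R_{z_i}=(M_{z_i}\otimes I_{\mathcal{E}})|_{\mathcal{S}}\in\mathcal{B}(\mathcal{S})$ and $\boldsymbol{R}_z=(R_{z_1},\dots,R_{z_n})$. $\mathcal{S}$ is a Brehmer submodule if $g^{-1}(\boldsymbol{R}_z,\boldsymbol{R}_z^* )\ge 0$ on $\mathcal{S}$, where for a polynomial $g^{-1}(\boldsymbol{z},\boldsymbol{w})=1/g(\boldsymbol{z},\boldsymbol{w})=\sum a_{\boldsymbol{k}\boldsymbol{l}}\boldsymbol{z}^{\boldsymbol{k}}\bar{\boldsymbol{w}}^{\boldsymbol{l}}$ one sets $g^{-1}(\boldsymbol{R}_z,\boldsymbol{R}_z^* )=\sum a_{\boldsymbol{k}\boldsymbol{l}}\boldsymbol{R}_z^{\boldsymbol{k}}\boldsymbol{R}_z^{*\boldsymbol{l}}$;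 here this means $\sum_{\boldsymbol{k}\in\{0,1\}^n}(-1)^{k_1+\cdots+k_n}\boldsymbol{R}_z^{\boldsymbol{k}}\boldsymbol{R}_z^{*\boldsymbol{k}}\ge 0$. $\mathcal{S}$ is doubly commuting if $R_{z_i}^*R_{z_j}-R_{z_j}R_{z_i}^*=0$ for all $1\le i\ne j\le n$. *)

theory Defs
  imports "HOL-Analysis.Analysis"
begin

section \<open>Complex Hilbert spaces\<close>

text \<open>The inner product is linear in the first argument. Completeness and the relation between
  norm, metric and topology are inherited from \<^class>\<open>banach\<close>.\<close>

class chilbert_space = banach +
  fixes scaleC :: "complex \<Rightarrow> 'a \<Rightarrow> 'a" (infixr "*\<^sub>C" 75)
    and cinner :: "'a \<Rightarrow> 'a \<Rightarrow> complex"
  assumes scaleC_add_right: "c *\<^sub>C (x + y) = c *\<^sub>C x + c *\<^sub>C y"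
    and scaleC_add_left: "(c + d) *\<^sub>C x = c *\<^sub>C x + d *\<^sub>C x"
    and scaleC_scaleC: "c *\<^sub>C d *\<^sub>C x = (c * d) *\<^sub>C x"
    and scaleC_of_real: "complex_of_real r *\<^sub>C x = r *\<^sub>R x"
    and cinner_commute: "cinner x y = cnj (cinner y x)"
    and cinner_add_left: "cinner (x + y) z = cinner x z + cinner y z"
    and cinner_scaleC_left: "cinner (c *\<^sub>C x) y = c * cinner x y"
    and cinner_self: "cinner x x = complex_of_real ((norm x)\<^sup>2)"

instantiation complex :: chilbert_space
begin
definition scaleC_complex :: "complex \<Rightarrow> complex \<Rightarrow> complex" where "scaleC_complex c x = c * x"
definition cinner_complex :: "complex \<Rightarrow> complex \<Rightarrow> complex" where "cinner_complex x y = x * cnj y"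
instance
  by standard (auto simp: scaleC_complex_def cinner_complex_def algebra_simps scaleR_conv_of_real
      complex_norm_square simp del: of_real_power)
end

lemma scaleC_one [simp]: "1 *\<^sub>C x = (x :: 'a::chilbert_space)"
  using scaleC_of_real[of 1 x] by simp

lemma scaleC_zero_left [simp]: "0 *\<^sub>C x = (0 :: 'a::chilbert_space)"
  using scaleC_of_real[of 0 x] by simp

lemma scaleC_zero_right [simp]: "c *\<^sub>C 0 = (0 :: 'a::chilbert_space)"
  using scaleC_add_right[of c 0 "0 :: 'a"] by simp

lemma scaleC_scaleR: "c *\<^sub>C r *\<^sub>R x = r *\<^sub>R c *\<^sub>C (x :: 'a::chilbert_space)"
  by (simp flip: scaleC_of_real add: scaleC_scaleC mult.commute)

lemma cinner_add_right: "cinner x (y + z) = cinner x y + cinner (x :: 'a::chilbert_space) z"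
  by (metis cinner_add_left cinner_commute complex_cnj_add)

lemma cinner_scaleC_right: "cinner x (c *\<^sub>C y) = cnj c * cinner (x :: 'a::chilbert_space) y"
  by (metis cinner_scaleC_left cinner_commute complex_cnj_mult)

lemma cinner_zero_left [simp]: "cinner 0 (x :: 'a::chilbert_space) = 0"
  using cinner_scaleC_left[of 0 0 x] by simp

lemma cinner_zero_right [simp]: "cinner (x :: 'a::chilbert_space) 0 = 0"
  using cinner_scaleC_right[of x 0 0] by simp

lemma norm_scaleC [simp]: "norm (c *\<^sub>C (x :: 'a::chilbert_space)) = cmod c * norm x"
proof -
  have "complex_of_real ((norm (c *\<^sub>C x))\<^sup>2) = c * cnj c * cinner x x"
    by (subst cinner_self[symmetric]) (simp add: cinner_scaleC_left cinner_scaleC_right)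
  also have "\<dots> = complex_of_real ((cmod c * norm x)\<^sup>2)"
    by (simp add: cinner_self power_mult_distrib complex_norm_square[symmetric] flip: of_real_mult of_real_power)
  finally have "(norm (c *\<^sub>C x))\<^sup>2 = (cmod c * norm x)\<^sup>2"
    using of_real_eq_iff by blast
  thus ?thesis by (simp add: power2_eq_iff_nonneg)
qed

lemma bounded_linear_scaleC: "bounded_linear (\<lambda>x :: 'a::chilbert_space. c *\<^sub>C x)"
  by (rule bounded_linear_intro[where K = "cmod c"])
    (auto simp: scaleC_add_right scaleC_scaleR mult.commute)

lemma bounded_linear_scaleC_left: "bounded_linear (\<lambda>c. c *\<^sub>C (x :: 'a::chilbert_space))"
  by (rule bounded_linear_intro[where K = "norm x"])
    (auto simp: scaleC_add_left scaleR_conv_of_real scaleC_of_real simp flip: scaleC_scaleC)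

lemma norm_cinner_le: "cmod (cinner x y) \<le> norm x * norm (y :: 'a::chilbert_space)"
proof (cases "y = 0")
  case False
  define t where "t = - (cinner x y / cinner y y)"
  have yy: "cinner y y \<noteq> 0" using False by (simp add: cinner_self)
  have "cinner (x + t *\<^sub>C y) (x + t *\<^sub>C y) * cinner y y
      = cinner x x * cinner y y - cinner x y * cnj (cinner x y)"
    using yy cinner_commute[of y y] cinner_commute[of y x]
    by (simp add: cinner_add_left cinner_add_right cinner_scaleC_left cinner_scaleC_right t_def
        field_simps)
  hence "complex_of_real ((norm (x + t *\<^sub>C y))\<^sup>2 * (norm y)\<^sup>2)
      = complex_of_real ((norm x)\<^sup>2 * (norm y)\<^sup>2 - (cmod (cinner x y))\<^sup>2)"
    unfolding complex_norm_square[symmetric] cinner_self by (simp del: of_real_power)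
  hence "(norm (x + t *\<^sub>C y))\<^sup>2 * (norm y)\<^sup>2 = (norm x)\<^sup>2 * (norm y)\<^sup>2 - (cmod (cinner x y))\<^sup>2"
    using of_real_eq_iff by blast
  moreover have "0 \<le> (norm (x + t *\<^sub>C y))\<^sup>2 * (norm y)\<^sup>2" by simp
  ultimately have "(cmod (cinner x y))\<^sup>2 \<le> (norm x * norm y)\<^sup>2" by (simp add: power_mult_distrib)
  thus ?thesis by (simp add: power2_le_iff_abs_le)
qed simp

lemma bounded_linear_cinner_left: "bounded_linear (\<lambda>x :: 'a::chilbert_space. cinner x y)"
  by (rule bounded_linear_intro[where K = "norm y"])
    (auto simp: cinner_add_left norm_cinner_le scaleR_conv_of_real
       cinner_scaleC_left simp flip: scaleC_of_real)

section \<open>Power series in several variables\<close>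

definition polydisc :: "(complex ^ 'n) set" where
  "polydisc = {z. \<forall>i. cmod (z $ i) < 1}"

definition mpow :: "'a::comm_semiring_1 ^ 'n \<Rightarrow> ('n \<Rightarrow> nat) \<Rightarrow> 'a" where
  "mpow z k = (\<Prod>i\<in>UNIV. (z $ i) ^ k i)"

lemma geometric_has_sum:
  assumes "norm (x :: 'a::{real_normed_field,banach}) < 1"
  shows "((\<lambda>n. x ^ n) has_sum 1 / (1 - x)) UNIV"
  using assms norm_summable_imp_has_sum[of "\<lambda>n. x ^ n" "1 / (1 - x)"] geometric_sums[of x]
  by (simp add: norm_power summable_geometric)

lemma mpow_has_sum:
  fixes z :: "complex ^ 'n::finite"
  assumes "z \<in> polydisc"
  shows "(mpow z has_sum (\<Prod>i\<in>UNIV. 1 / (1 - z $ i))) UNIV"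
proof -
  have lt: "norm (z $ i) < 1" for i using assms by (auto simp: polydisc_def)
  have "infsum (\<lambda>g. \<Prod>i\<in>UNIV. (z $ i) ^ g i) (PiE UNIV (\<lambda>_. UNIV))
      = (\<Prod>i\<in>UNIV. infsum (\<lambda>n. (z $ i) ^ n) UNIV)"
    by (rule infsum_prod_PiE_abs)
      (use geometric_has_sum[of "norm (z $ i)" for i] lt in \<open>auto simp: norm_power summable_on_def\<close>)
  also have "\<dots> = (\<Prod>i\<in>UNIV. 1 / (1 - z $ i))"
    by (intro prod.cong infsumI geometric_has_sum lt refl)
  finally have *: "infsum (mpow z) UNIV = (\<Prod>i\<in>UNIV. 1 / (1 - z $ i))"
    unfolding mpow_def[abs_def] by (simp add: PiE_UNIV_domain)
  moreover have "(\<Prod>i\<in>UNIV. 1 / (1 - z $ i)) \<noteq> 0"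
  proof -
    have "1 - z $ i \<noteq> 0" for i using lt[of i] by (cases "z $ i = 1") auto
    thus ?thesis by (simp add: prod_zero_iff)
  qed
  ultimately have "mpow z summable_on UNIV" by (metis infsum_not_exists)
  thus ?thesis using * by (metis has_sum_infsum)
qed

lemma mpow_summable:
  fixes z :: "complex ^ 'n::finite"
  assumes "z \<in> polydisc"
  shows "(\<lambda>k. cmod (mpow z k)) summable_on UNIV" "(\<lambda>k. (cmod (mpow z k))\<^sup>2) summable_on UNIV"
proof -
  show 1: "(\<lambda>k. cmod (mpow z k)) summable_on UNIV"
    using mpow_has_sum[OF assms] summable_on_def summable_on_iff_abs_summable_on_complex by blast
  have "cmod (mpow z k) \<le> 1" for k
    unfolding mpow_def prod_norm[symmetric]
    using assms by (intro prod_le_1 conjI) (simp_all add: polydisc_def norm_power power_le_one order.strict_implies_order)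
  hence "(cmod (mpow z k))\<^sup>2 \<le> cmod (mpow z k)" for k
    by (metis norm_ge_zero power2_eq_square mult_left_le)
  thus "(\<lambda>k. (cmod (mpow z k))\<^sup>2) summable_on UNIV"
    by (intro summable_on_comparison_test[OF 1]) auto
qed

lemma powser_unique_1:
  assumes "\<And>w. cmod w < 1 \<Longrightarrow> (\<lambda>m. c m * w ^ m) sums 0"
  shows "c m = 0"
proof -
  have "1 \<le> conv_radius c"
  proof (rule conv_radius_geI_ex')
    fix r :: real assume "0 < r" "ereal r < 1"
    hence "cmod (of_real r) < 1" by simp
    thus "summable (\<lambda>n. c n * of_real r ^ n)" using assms sums_summable by blast
  qed
  hence "0 < fps_conv_radius (Abs_fps c)"
    by (simp add: fps_conv_radius_def) (rule less_le_trans[of 0 1], simp_all)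
  moreover have "eventually (\<lambda>z. eval_fps (Abs_fps c) z = eval_fps 0 z) (nhds 0)"
    unfolding eventually_nhds_metric
    using assms by (auto intro!: exI[of _ 1] simp: eval_fps_def sums_unique[symmetric])
  ultimately have "Abs_fps c = 0"
    by (intro eval_fps_eqD) auto
  thus ?thesis by (metis fps_nth_Abs_fps fps_zero_nth)
qed

lemma mpow_upd:
  fixes z :: "complex ^ 'n::finite"
  shows "mpow (\<chi> i. if i = j then w else z $ i) (k(j := m))
    = w ^ m * mpow z (k(j := 0))"
proof -
  have "mpow (\<chi> i. if i = j then w else z $ i) (k(j := m)) = w ^ m * (\<Prod>i\<in>UNIV - {j}. (z $ i) ^ k i)"
    unfolding mpow_def by (subst prod.remove[of _ j]) auto
  moreover have "mpow z (k(j := 0)) = (\<Prod>i\<in>UNIV - {j}. (z $ i) ^ k i)"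
    unfolding mpow_def by (subst prod.remove[of _ j]) auto
  ultimately show ?thesis by simp
qed

lemma mpowser_unique:
  fixes a :: "('n::finite \<Rightarrow> nat) \<Rightarrow> complex"
  assumes "finite A"
    and "\<And>k. a k \<noteq> 0 \<Longrightarrow> \<forall>i. i \<notin> A \<longrightarrow> k i = 0"
    and "\<And>z. z \<in> polydisc \<Longrightarrow> ((\<lambda>k. mpow z k * a k) has_sum 0) UNIV"
  shows "a k = 0"
  using assms
proof (induction A arbitrary: a k rule: finite_induct)
  case empty
  define k0 where "k0 = (\<lambda>_ :: 'n. 0 :: nat)"
  have supp: "a k = 0" if "k \<noteq> k0" for k
    using empty(1)[of k] that unfolding k0_def by (metis empty_iff ext)
  let ?g = "\<lambda>k. mpow (0 :: complex ^ 'n) k * a k"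
  have "(?g has_sum 0) UNIV"
    by (rule empty) (simp add: polydisc_def)
  moreover have "(?g has_sum ?g k0) {k0}" using has_sum_finite[of "{k0}" ?g] by simp
  hence "(?g has_sum ?g k0) UNIV"
    using has_sum_cong_neutral[of UNIV "{k0}" ?g ?g] supp by simp
  ultimately have "?g k0 = 0" using has_sum_unique by blast
  hence "a k0 = 0" by (simp add: mpow_def k0_def)
  thus ?case using supp[of k] by metis
next
  case (insert j A)
  define b where "b m k = (if k j = 0 then a (k(j := m)) else 0)" for m :: nat and k :: "'n \<Rightarrow> nat"
  define Z where "Z = {k :: 'n \<Rightarrow> nat. k j = 0}"
  have bij: "bij_betw (\<lambda>(m, k). k(j := m)) (UNIV \<times> Z) UNIV"
    by (rule bij_betw_byWitness[where f' = "\<lambda>k. (k j, k(j := 0))"])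
      (auto simp: Z_def fun_eq_iff)
  have b0: "b m k = 0" for m k
  proof (rule insert.IH)
    fix k' assume "b m k' \<noteq> 0"
    thus "\<forall>i. i \<notin> A \<longrightarrow> k' i = 0"
      using insert.prems(1)[of "k'(j := m)"] unfolding b_def
      by (metis fun_upd_other insert_iff)
  next
    fix z :: "complex ^ 'n" assume z: "z \<in> polydisc"
    define c where "c m = infsum (\<lambda>k. mpow z k * b m k) Z" for m
    have inner: "((\<lambda>p. case p of (m, k) \<Rightarrow> w ^ m * (mpow z k * b m k)) has_sum 0) (UNIV \<times> Z)"
      if "cmod w < 1" for w
    proof -
      have "(\<chi> i. if i = j then w else z $ i) \<in> polydisc"
        using z that by (auto simp: polydisc_def)
      from insert.prems(2)[OF this]
      have "((\<lambda>p. case p of (m, k) \<Rightarrow>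
          mpow (\<chi> i. if i = j then w else z $ i) (k(j := m)) * a (k(j := m))) has_sum 0) (UNIV \<times> Z)"
        by (subst (asm) has_sum_reindex_bij_betw[OF bij, symmetric]) (simp add: case_prod_unfold)
      also have "?this \<longleftrightarrow> ?thesis"
        by (rule has_sum_cong) (auto simp: mpow_upd b_def Z_def fun_upd_idem mult.assoc)
      finally show ?thesis .
    qed
    have sm: "(\<lambda>k. mpow z k * b m k) summable_on Z" for m
    proof -
      have "(\<lambda>p. case p of (m, k) \<Rightarrow> (1/2) ^ m * (mpow z k * b m k)) summable_on (UNIV \<times> Z)"
        using inner[of "1/2"] by (auto simp: summable_on_def)
      hence "(\<lambda>p. case p of (m, k) \<Rightarrow> (1/2) ^ m * (mpow z k * b m k)) summable_on (Pair m ` Z)"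
        by (rule summable_on_subset_banach) auto
      hence "(\<lambda>k. (1/2) ^ m * (mpow z k * b m k)) summable_on Z"
        by (subst (asm) summable_on_reindex) (auto simp: inj_on_def o_def)
      thus ?thesis by (subst (asm) summable_on_cmult_right') auto
    qed
    have "(\<lambda>m. c m * w ^ m) sums 0" if "cmod w < 1" for w
    proof -
      have "((\<lambda>m. w ^ m * c m) has_sum 0) UNIV"
        by (rule has_sum_SigmaD[OF inner[OF that]])
          (auto simp: c_def intro!: has_sum_cmult_right has_sum_infsum sm)
      thus ?thesis by (simp add: has_sum_imp_sums mult.commute)
    qed
    hence "c m = 0" by (rule powser_unique_1)
    hence "((\<lambda>k. mpow z k * b m k) has_sum 0) Z"
      using sm[of m] by (metis c_def has_sum_infsum)
    also have "?this \<longleftrightarrow> ((\<lambda>k. mpow z k * b m k) has_sum 0) UNIV"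
      by (rule has_sum_cong_neutral) (auto simp: Z_def b_def)
    finally show "((\<lambda>k. mpow z k * b m k) has_sum 0) UNIV" .
  qed
  show ?case using b0[of "k j" "k(j := 0)"] by (simp add: b_def)
qed


section \<open>The Hardy space of the polydisc\<close>

text \<open>\<open>has_coeffs f a\<close>: \<open>f\<close> is the function with square-summable Taylor coefficients \<open>a\<close> on the
  polydisc; it is extended by zero, so that distinct total functions are distinct on the polydisc.\<close>

definition has_coeffs :: "(complex ^ 'n \<Rightarrow> 'e::chilbert_space) \<Rightarrow> (('n::finite \<Rightarrow> nat) \<Rightarrow> 'e) \<Rightarrow> bool" where
  "has_coeffs f a \<longleftrightarrow> (\<lambda>k. (norm (a k))\<^sup>2) summable_on UNIV \<and>
    (\<forall>z\<in>polydisc. ((\<lambda>k. mpow z k *\<^sub>C a k) has_sum f z) UNIV) \<and> (\<forall>z. z \<notin> polydisc \<longrightarrow> f z = 0)"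

lemma L2_set_le_l2:
  assumes "(\<lambda>k. (norm (a k))\<^sup>2) summable_on UNIV"
  shows "L2_set (\<lambda>k. norm (a k)) F \<le> sqrt (\<Sum>\<^sub>\<infinity>k. (norm (a k))\<^sup>2)"
proof (cases "finite F")
  case True
  have "(\<Sum>k\<in>F. (norm (a k))\<^sup>2) \<le> (\<Sum>\<^sub>\<infinity>k. (norm (a k))\<^sup>2)"
    using assms True by (intro finite_sum_le_infsum) auto
  thus ?thesis by (simp add: L2_set_def)
qed (simp add: infsum_nonneg)

lemma l2_boundI:
  fixes a :: "'k \<Rightarrow> 'e::real_normed_vector"
  assumes "\<And>F. finite F \<Longrightarrow> L2_set (\<lambda>k. norm (a k)) F \<le> C"
  shows "(\<lambda>k. (norm (a k))\<^sup>2) summable_on UNIV" "sqrt (\<Sum>\<^sub>\<infinity>k. (norm (a k))\<^sup>2) \<le> C"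
proof -
  have C: "0 \<le> C" using assms[of "{}"] by simp
  have le: "(\<Sum>k\<in>F. (norm (a k))\<^sup>2) \<le> C\<^sup>2" if "finite F" for F
    using assms[OF that] by (simp add: L2_set_def real_sqrt_le_iff real_le_lsqrt sqrt_le_D)
  show *: "(\<lambda>k. (norm (a k))\<^sup>2) summable_on UNIV"
    by (rule nonneg_bdd_above_summable_on) (use le in \<open>auto intro!: bdd_aboveI2\<close>)
  have "(\<Sum>\<^sub>\<infinity>k. (norm (a k))\<^sup>2) \<le> C\<^sup>2"
    by (rule infsum_le_finite_sums[OF *]) (use le in auto)
  thus "sqrt (\<Sum>\<^sub>\<infinity>k. (norm (a k))\<^sup>2) \<le> C" using C by (simp add: real_le_lsqrt)
qed

lemma l2_add:
  fixes a b :: "'k \<Rightarrow> 'e::real_normed_vector"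
  assumes "(\<lambda>k. (norm (a k))\<^sup>2) summable_on UNIV" "(\<lambda>k. (norm (b k))\<^sup>2) summable_on UNIV"
  shows "(\<lambda>k. (norm (a k + b k))\<^sup>2) summable_on UNIV"
    "sqrt (\<Sum>\<^sub>\<infinity>k. (norm (a k + b k))\<^sup>2) \<le> sqrt (\<Sum>\<^sub>\<infinity>k. (norm (a k))\<^sup>2) + sqrt (\<Sum>\<^sub>\<infinity>k. (norm (b k))\<^sup>2)"
proof -
  have "L2_set (\<lambda>k. norm (a k + b k)) F \<le> sqrt (\<Sum>\<^sub>\<infinity>k. (norm (a k))\<^sup>2) + sqrt (\<Sum>\<^sub>\<infinity>k. (norm (b k))\<^sup>2)" for F
  proof -
    have "L2_set (\<lambda>k. norm (a k + b k)) F \<le> L2_set (\<lambda>k. norm (a k) + norm (b k)) F"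
      by (rule L2_set_mono) (auto intro: norm_triangle_ineq)
    also have "\<dots> \<le> L2_set (\<lambda>k. norm (a k)) F + L2_set (\<lambda>k. norm (b k)) F"
      by (rule L2_set_triangle_ineq)
    finally show ?thesis using L2_set_le_l2[OF assms(1), of F] L2_set_le_l2[OF assms(2), of F] by linarith
  qed
  from l2_boundI[of "\<lambda>k. a k + b k", OF this] show
    "(\<lambda>k. (norm (a k + b k))\<^sup>2) summable_on UNIV"
    "sqrt (\<Sum>\<^sub>\<infinity>k. (norm (a k + b k))\<^sup>2) \<le> sqrt (\<Sum>\<^sub>\<infinity>k. (norm (a k))\<^sup>2) + sqrt (\<Sum>\<^sub>\<infinity>k. (norm (b k))\<^sup>2)"
    by auto
qed

lemma l2_scaleC:
  fixes a :: "'k \<Rightarrow> 'e::chilbert_space"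
  assumes "(\<lambda>k. (norm (a k))\<^sup>2) summable_on UNIV"
  shows "(\<lambda>k. (norm (c *\<^sub>C a k))\<^sup>2) summable_on UNIV"
  using assms by (auto simp: power_mult_distrib intro: summable_on_cmult_right)

lemma abs_summable_mult_l2:
  fixes f :: "'k \<Rightarrow> 'e::banach"
  assumes "(\<lambda>k. (x k)\<^sup>2) summable_on UNIV" "(\<lambda>k. (y k :: real)\<^sup>2) summable_on UNIV"
    and "\<And>k. norm (f k) \<le> x k * y k"
  shows "f summable_on UNIV"
proof -
  have "norm (f k) \<le> (x k)\<^sup>2 + (y k)\<^sup>2" for k
    using assms(3)[of k] sum_squares_bound[of "x k" "y k"] zero_le_power2[of "x k"] zero_le_power2[of "y k"]
      norm_ge_zero[of "f k"]
    by linarith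
  hence "f abs_summable_on UNIV"
    by (intro summable_on_comparison_test[OF summable_on_add[OF assms(1,2)]]) auto
  thus ?thesis by (rule abs_summable_summable)
qed

lemma has_coeffs_ex:
  fixes a :: "('n::finite \<Rightarrow> nat) \<Rightarrow> 'e::chilbert_space"
  assumes "(\<lambda>k. (norm (a k))\<^sup>2) summable_on UNIV"
  shows "\<exists>f. has_coeffs f a"
proof
  have "(\<lambda>k. mpow z k *\<^sub>C a k) summable_on UNIV" if "z \<in> polydisc" for z
    by (rule abs_summable_mult_l2[OF mpow_summable(2)[OF that] assms]) simp
  thus "has_coeffs (\<lambda>z. if z \<in> polydisc then \<Sum>\<^sub>\<infinity>k. mpow z k *\<^sub>C a k else 0) a"
    using assms by (auto simp: has_coeffs_def)
qed

lemma has_coeffs_fun_unique: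
  assumes "has_coeffs f a" "has_coeffs g a"
  shows "f = g"
proof
  fix z show "f z = g z"
    using assms unfolding has_coeffs_def by (cases "z \<in> polydisc") (metis has_sum_unique, simp)
qed

lemma has_coeffs_add:
  "has_coeffs f a \<Longrightarrow> has_coeffs g b \<Longrightarrow> has_coeffs (\<lambda>z. f z + g z) (\<lambda>k. a k + b k)"
  unfolding has_coeffs_def by (auto simp: scaleC_add_right intro!: has_sum_add l2_add)

lemma has_coeffs_scaleC:
  assumes "has_coeffs f a"
  shows "has_coeffs (\<lambda>z. c *\<^sub>C f z) (\<lambda>k. c *\<^sub>C a k)"
proof -
  have "((\<lambda>k. mpow z k *\<^sub>C c *\<^sub>C a k) has_sum c *\<^sub>C f z) UNIV"
    if "((\<lambda>k. mpow z k *\<^sub>C a k) has_sum f z) UNIV" for z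
    using has_sum_bounded_linear[OF bounded_linear_scaleC that, of c]
    by (simp add: scaleC_scaleC mult.commute)
  thus ?thesis using assms unfolding has_coeffs_def by (auto intro: l2_scaleC simp del: norm_scaleC)
qed

lemma scaleC_minus_one: "(-1) *\<^sub>C x = - (x :: 'a::chilbert_space)"
  using scaleC_of_real[of "-1" x] by simp

lemma has_coeffs_diff:
  assumes "has_coeffs f a" "has_coeffs g b"
  shows "has_coeffs (\<lambda>z. f z - g z) (\<lambda>k. a k - b k)"
  using has_coeffs_add[OF assms(1) has_coeffs_scaleC[OF assms(2), of "-1"]]
  by (simp add: scaleC_minus_one)

lemma has_coeffs_unique:
  fixes f :: "complex ^ 'n::finite \<Rightarrow> 'e::chilbert_space"
  assumes "has_coeffs f a" "has_coeffs f b"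
  shows "a = b"
proof
  fix k
  let ?y = "a k - b k"
  have "cinner (a k - b k) ?y = 0"
  proof (rule mpowser_unique[of UNIV "\<lambda>k. cinner (a k - b k) ?y"])
    fix z :: "complex ^ 'n" assume "z \<in> polydisc"
    hence "((\<lambda>k. mpow z k *\<^sub>C (a k - b k)) has_sum 0) UNIV"
      using has_coeffs_diff[OF assms] by (auto simp: has_coeffs_def)
    from has_sum_bounded_linear[OF bounded_linear_cinner_left this, of ?y]
    show "((\<lambda>k'. mpow z k' * cinner (a k' - b k') ?y) has_sum 0) UNIV"
      by (simp add: cinner_scaleC_left)
  qed auto
  thus "a k = b k" by (simp add: cinner_self)
qed

text \<open>\<open>('e, 'n) hardy\<close> is the Hilbert space \<open>H\<^sup>2(\<D>\<^sup>n) \<otimes> \<E>\<close>, realised as the \<open>\<E>\<close>-valued Hardy space,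
  where \<open>'n\<close> is an index type with \<open>n\<close> elements and \<open>\<E>\<close> is the type \<open>'e\<close>. Lemma
  \<open>hardy_reproducing\<close> shows that its reproducing kernel is \<open>g(z, w) I\<close> with
  \<open>g(z, w) = \<Prod>\<^sub>i (1 - z\<^sub>i cnj w\<^sub>i)\<inverse>\<close>.\<close>

typedef (overloaded) ('e::chilbert_space, 'n::finite) hardy =
    "{f :: complex ^ 'n \<Rightarrow> 'e. \<exists>a. has_coeffs f a}"
  morphisms heval Abs_hardy
  using has_coeffs_ex[of "\<lambda>_. 0"] by auto

definition hcoeff :: "('e::chilbert_space, 'n::finite) hardy \<Rightarrow> ('n \<Rightarrow> nat) \<Rightarrow> 'e" where
  "hcoeff f = (THE a. has_coeffs (heval f) a)"

lemma hcoeff_works: "has_coeffs (heval f) (hcoeff f)"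
proof -
  obtain a where "has_coeffs (heval f) a" using heval[of f] by auto
  hence "(THE a. has_coeffs (heval f) a) = a" by (auto intro: has_coeffs_unique)
  thus ?thesis using \<open>has_coeffs (heval f) a\<close> by (simp add: hcoeff_def)
qed

lemma Abs_hardy:
  assumes "has_coeffs f a"
  shows "heval (Abs_hardy f) = f" "hcoeff (Abs_hardy f) = a"
proof -
  show *: "heval (Abs_hardy f) = f" by (rule Abs_hardy_inverse) (use assms in auto)
  show "hcoeff (Abs_hardy f) = a"
    using hcoeff_works[of "Abs_hardy f"] has_coeffs_unique[OF assms] by (simp add: *)
qed

lemma hcoeff_summable: "(\<lambda>k. (norm (hcoeff f k))\<^sup>2) summable_on UNIV"
  using hcoeff_works[of f] by (simp add: has_coeffs_def)

lemma hardy_eqI: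
  assumes "\<And>k. hcoeff f k = hcoeff g k"
  shows "f = g"
  using assms has_coeffs_fun_unique[of "heval f" "hcoeff f" "heval g"] hcoeff_works[of f] hcoeff_works[of g]
  by (metis ext heval_inject)

lemma hardy_of_coeffs:
  assumes "(\<lambda>k. (norm (a k))\<^sup>2) summable_on UNIV"
  obtains f where "hcoeff f = a"
  using has_coeffs_ex[OF assms] Abs_hardy(2) by blast

instantiation hardy :: (chilbert_space, finite) real_normed_vector
begin

definition zero_hardy :: "('a, 'b) hardy" where
  "0 = Abs_hardy (\<lambda>_. 0)"
definition plus_hardy :: "('a, 'b) hardy \<Rightarrow> ('a, 'b) hardy \<Rightarrow> ('a, 'b) hardy" where
  "f + g = Abs_hardy (\<lambda>z. heval f z + heval g z)"
definition minus_hardy :: "('a, 'b) hardy \<Rightarrow> ('a, 'b) hardy \<Rightarrow> ('a, 'b) hardy" where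
  "f - g = Abs_hardy (\<lambda>z. heval f z - heval g z)"
definition uminus_hardy :: "('a, 'b) hardy \<Rightarrow> ('a, 'b) hardy" where
  "- f = Abs_hardy (\<lambda>z. - heval f z)" for f :: "('a, 'b) hardy"
definition scaleR_hardy :: "real \<Rightarrow> ('a, 'b) hardy \<Rightarrow> ('a, 'b) hardy" where
  "r *\<^sub>R f = Abs_hardy (\<lambda>z. r *\<^sub>R heval f z)"
definition norm_hardy :: "('a, 'b) hardy \<Rightarrow> real" where
  "norm f = sqrt (\<Sum>\<^sub>\<infinity>k. (norm (hcoeff f k))\<^sup>2)"
definition dist_hardy :: "('a, 'b) hardy \<Rightarrow> ('a, 'b) hardy \<Rightarrow> real" where
  "dist f g = norm (f - g)" for f g :: "('a, 'b) hardy"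
definition sgn_hardy :: "('a, 'b) hardy \<Rightarrow> ('a, 'b) hardy" where
  "sgn f = inverse (norm f) *\<^sub>R f" for f :: "('a, 'b) hardy"
definition uniformity_hardy :: "(('a, 'b) hardy \<times> ('a, 'b) hardy) filter" where
  "uniformity_hardy = (INF e\<in>{0<..}. principal {(x, y). dist x y < e})"
definition open_hardy :: "('a, 'b) hardy set \<Rightarrow> bool" where
  "open_hardy U \<longleftrightarrow> (\<forall>x\<in>U. \<forall>\<^sub>F (x', y) in uniformity. x' = x \<longrightarrow> y \<in> U)"

lemma zero_hardy_works: "heval (0 :: ('a, 'b) hardy) = (\<lambda>_. 0)" "hcoeff (0 :: ('a, 'b) hardy) k = 0"
proof -
  have "has_coeffs (\<lambda>_ :: complex ^ 'b. 0 :: 'a) (\<lambda>_. 0)" by (simp add: has_coeffs_def)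
  from Abs_hardy[OF this] show "heval (0 :: ('a, 'b) hardy) = (\<lambda>_. 0)" "hcoeff (0 :: ('a, 'b) hardy) k = 0"
    by (simp_all add: zero_hardy_def)
qed

lemma plus_hardy_works: "heval (f + g) = (\<lambda>z. heval f z + heval g z)"
  "hcoeff (f + g) k = hcoeff f k + hcoeff g k" for f g :: "('a, 'b) hardy"
  using Abs_hardy[OF has_coeffs_add[OF hcoeff_works hcoeff_works], of f g] by (simp_all add: plus_hardy_def)

lemma minus_hardy_works: "heval (f - g) = (\<lambda>z. heval f z - heval g z)"
  "hcoeff (f - g) k = hcoeff f k - hcoeff g k" for f g :: "('a, 'b) hardy"
  using Abs_hardy[OF has_coeffs_diff[OF hcoeff_works hcoeff_works], of f g] by (simp_all add: minus_hardy_def)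

lemma scaleR_hardy_works: "heval (r *\<^sub>R f) = (\<lambda>z. r *\<^sub>R heval f z)"
  "hcoeff (r *\<^sub>R f) k = r *\<^sub>R hcoeff f k" for f :: "('a, 'b) hardy"
  using Abs_hardy[OF has_coeffs_scaleC[OF hcoeff_works], of "complex_of_real r" f]
  by (simp_all add: scaleR_hardy_def scaleC_of_real)

lemma uminus_hardy_works: "heval (- f) = (\<lambda>z. - heval f z)"
  "hcoeff (- f) k = - hcoeff f k" for f :: "('a, 'b) hardy"
  using Abs_hardy[OF has_coeffs_scaleC[OF hcoeff_works], of "-1" f]
  by (simp_all add: uminus_hardy_def scaleC_minus_one)

lemma norm_hcoeff_le: "norm (hcoeff f k) \<le> norm f" for f :: "('a, 'b) hardy"
  using L2_set_le_l2[OF hcoeff_summable[of f], of "{k}"] by (simp add: norm_hardy_def L2_set_def)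

lemma norm_hardy_sq: "(norm f)\<^sup>2 = (\<Sum>\<^sub>\<infinity>k. (norm (hcoeff f k))\<^sup>2)" for f :: "('a, 'b) hardy"
  by (simp add: norm_hardy_def infsum_nonneg)

lemmas hardy_works = zero_hardy_works plus_hardy_works minus_hardy_works
  scaleR_hardy_works uminus_hardy_works

instance
proof
  fix f g h :: "('a, 'b) hardy" and r s :: real
  show "f + g + h = f + (g + h)" by (rule hardy_eqI) (simp add: hardy_works)
  show "f + g = g + f" by (rule hardy_eqI) (simp add: hardy_works)
  show "0 + f = f" by (rule hardy_eqI) (simp add: hardy_works)
  show "- f + f = 0" by (rule hardy_eqI) (simp add: hardy_works)
  show "f - g = f + - g" by (rule hardy_eqI) (simp add: hardy_works)
  show "r *\<^sub>R (f + g) = r *\<^sub>R f + r *\<^sub>R g" by (rule hardy_eqI) (simp add: hardy_works scaleR_add_right)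
  show "(r + s) *\<^sub>R f = r *\<^sub>R f + s *\<^sub>R f" by (rule hardy_eqI) (simp add: hardy_works scaleR_add_left)
  show "r *\<^sub>R s *\<^sub>R f = (r * s) *\<^sub>R f" by (rule hardy_eqI) (simp add: hardy_works)
  show "1 *\<^sub>R f = f" by (rule hardy_eqI) (simp add: hardy_works)
  show "dist f g = norm (f - g)" by (rule dist_hardy_def)
  show "sgn f = inverse (norm f) *\<^sub>R f" by (rule sgn_hardy_def)
  show "(uniformity :: (('a, 'b) hardy \<times> ('a, 'b) hardy) filter)
      = (INF e\<in>{0<..}. principal {(x, y). dist x y < e})" by (rule uniformity_hardy_def)
  show "open U = (\<forall>x\<in>U. \<forall>\<^sub>F (x', y) in uniformity. x' = x \<longrightarrow> y \<in> U)" for U :: "('a, 'b) hardy set"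
    by (rule open_hardy_def)
  show "(norm f = 0) = (f = 0)"
  proof
    assume "norm f = 0"
    hence "hcoeff f k = 0" for k using norm_hcoeff_le[of f k] by simp
    thus "f = 0" by (intro hardy_eqI) (simp add: hardy_works)
  qed (simp add: norm_hardy_def hardy_works)
  show "norm (f + g) \<le> norm f + norm g"
    unfolding norm_hardy_def plus_hardy_works by (rule l2_add(2)) (rule hcoeff_summable)+
  show "norm (r *\<^sub>R f) = \<bar>r\<bar> * norm f"
    by (simp add: norm_hardy_def hardy_works power_mult_distrib infsum_cmult_right' real_sqrt_mult)
qed

end

instance hardy :: (chilbert_space, finite) banach
proof
  fix X :: "nat \<Rightarrow> ('a, 'b) hardy"
  assume "Cauchy X"
  hence cau: "\<exists>M. \<forall>m\<ge>M. \<forall>n\<ge>M. norm (X m - X n) < e" if "0 < e" for e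
    using that unfolding Cauchy_def dist_hardy_def by blast
  have "Cauchy (\<lambda>m. hcoeff (X m) k)" for k
  proof (rule CauchyI)
    fix e :: real assume "0 < e"
    then obtain M where M: "\<forall>m\<ge>M. \<forall>n\<ge>M. norm (X m - X n) < e" using cau by blast
    have "norm (hcoeff (X m) k - hcoeff (X n) k) \<le> norm (X m - X n)" for m n
      using norm_hcoeff_le[of "X m - X n" k] by (simp add: hardy_works)
    thus "\<exists>M. \<forall>m\<ge>M. \<forall>n\<ge>M. norm (hcoeff (X m) k - hcoeff (X n) k) < e"
      using M by (meson le_less_trans)
  qed
  hence "\<exists>l. (\<lambda>m. hcoeff (X m) k) \<longlonglongrightarrow> l" for k
    using Cauchy_convergent convergent_def by blast
  then obtain a where a: "\<And>k. (\<lambda>m. hcoeff (X m) k) \<longlonglongrightarrow> a k" by metis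
  have bound: "L2_set (\<lambda>k. norm (hcoeff (X m) k - a k)) F \<le> e"
    if "\<forall>m\<ge>M. \<forall>n\<ge>M. norm (X m - X n) < e" "M \<le> m" for m M e F
  proof (rule LIMSEQ_le_const2)
    show "(\<lambda>n. L2_set (\<lambda>k. norm (hcoeff (X m) k - hcoeff (X n) k)) F)
        \<longlonglongrightarrow> L2_set (\<lambda>k. norm (hcoeff (X m) k - a k)) F"
      unfolding L2_set_def by (intro tendsto_intros a)
    have "L2_set (\<lambda>k. norm (hcoeff (X m) k - hcoeff (X n) k)) F \<le> norm (X m - X n)" for n
      using L2_set_le_l2[OF hcoeff_summable[of "X m - X n"], of F] by (simp add: hardy_works norm_hardy_def)
    thus "\<exists>N. \<forall>n\<ge>N. L2_set (\<lambda>k. norm (hcoeff (X m) k - hcoeff (X n) k)) F \<le> e"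
      using that by (meson less_imp_le order.trans)
  qed
  obtain M where M: "\<forall>m\<ge>M. \<forall>n\<ge>M. norm (X m - X n) < 1" using cau[of 1] by auto
  have "(\<lambda>k. (norm (hcoeff (X M) k - a k))\<^sup>2) summable_on UNIV"
    by (rule l2_boundI(1)) (rule bound[OF M order_refl])
  then obtain d where d: "hcoeff d = (\<lambda>k. hcoeff (X M) k - a k)"
    by (rule hardy_of_coeffs[of "\<lambda>k. hcoeff (X M) k - a k"])
  define f where "f = X M - d"
  have f: "hcoeff f k = a k" for k by (simp add: f_def hardy_works d)
  have "X \<longlonglongrightarrow> f"
  proof (rule metric_LIMSEQ_I)
    fix e :: real assume "0 < e"
    then obtain M where M: "\<forall>m\<ge>M. \<forall>n\<ge>M. norm (X m - X n) < e / 2" using cau[of "e/2"] by auto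
    have "norm (X m - f) \<le> e / 2" if "M \<le> m" for m
      unfolding norm_hardy_def hardy_works f by (rule l2_boundI(2)) (rule bound[OF M that])
    thus "\<exists>M. \<forall>m\<ge>M. dist (X m) f < e"
      using \<open>0 < e\<close> unfolding dist_hardy_def by (intro exI[of _ M]) (force simp: field_simps)
  qed
  thus "convergent X" by (auto simp: convergent_def)
qed

instantiation hardy :: (chilbert_space, finite) chilbert_space
begin

definition scaleC_hardy :: "complex \<Rightarrow> ('a, 'b) hardy \<Rightarrow> ('a, 'b) hardy" where
  "c *\<^sub>C f = Abs_hardy (\<lambda>z. c *\<^sub>C heval f z)"
definition cinner_hardy :: "('a, 'b) hardy \<Rightarrow> ('a, 'b) hardy \<Rightarrow> complex" where
  "cinner f g = (\<Sum>\<^sub>\<infinity>k. cinner (hcoeff f k) (hcoeff g k))"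

lemma scaleC_hardy_works: "heval (c *\<^sub>C f) = (\<lambda>z. c *\<^sub>C heval f z)"
  "hcoeff (c *\<^sub>C f) k = c *\<^sub>C hcoeff f k" for f :: "('a, 'b) hardy"
  using Abs_hardy[OF has_coeffs_scaleC[OF hcoeff_works], of c f] by (simp_all add: scaleC_hardy_def)

lemma cinner_hcoeff_summable: "(\<lambda>k. cinner (hcoeff f k) (hcoeff g k)) summable_on UNIV"
  for f g :: "('a, 'b) hardy"
  by (rule abs_summable_mult_l2[OF hcoeff_summable[of f] hcoeff_summable[of g] norm_cinner_le])

instance
proof
  fix f g h :: "('a, 'b) hardy" and c d :: complex and r :: real
  show "c *\<^sub>C (f + g) = c *\<^sub>C f + c *\<^sub>C g" by (rule hardy_eqI) (simp add: hardy_works scaleC_hardy_works scaleC_add_right)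
  show "(c + d) *\<^sub>C f = c *\<^sub>C f + d *\<^sub>C f" by (rule hardy_eqI) (simp add: hardy_works scaleC_hardy_works scaleC_add_left)
  show "c *\<^sub>C d *\<^sub>C f = (c * d) *\<^sub>C f" by (rule hardy_eqI) (simp add: hardy_works scaleC_hardy_works scaleC_scaleC)
  show "complex_of_real r *\<^sub>C f = r *\<^sub>R f" 
    by (rule hardy_eqI) (simp add: hardy_works scaleC_hardy_works scaleC_of_real)
  show "cinner f g = cnj (cinner g f)"
    unfolding cinner_hardy_def infsum_cnj[symmetric] by (rule infsum_cong) (rule cinner_commute)
  show "cinner (f + g) h = cinner f h + cinner g h"
    by (simp add: cinner_hardy_def hardy_works cinner_add_left infsum_add cinner_hcoeff_summable)
  show "cinner (c *\<^sub>C f) g = c * cinner f g"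
    by (simp add: cinner_hardy_def scaleC_hardy_works cinner_scaleC_left infsum_cmult_right')
  show "cinner f f = complex_of_real ((norm f)\<^sup>2)"
    unfolding cinner_hardy_def norm_hardy_sq cinner_self
    by (rule infsumI, rule has_sum_of_real, rule has_sum_infsum, rule hcoeff_summable)
qed

end

lemma hardy_reproducing:
  fixes w :: "complex ^ 'n::finite" and \<eta> :: "'e::chilbert_space"
  defines "g \<equiv> \<lambda>z. \<Prod>i\<in>UNIV. inverse (1 - z $ i * cnj (w $ i))"
  assumes w: "w \<in> polydisc"
  shows "\<exists>k :: ('e, 'n) hardy. heval k = (\<lambda>z. if z \<in> polydisc then g z *\<^sub>C \<eta> else 0) \<and>
    (\<forall>f. cinner f k = cinner (heval f w) \<eta>)"
proof -
  let ?a = "\<lambda>k. cnj (mpow w k) *\<^sub>C \<eta>"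
  let ?k = "\<lambda>z. if z \<in> polydisc then g z *\<^sub>C \<eta> else 0"
  have "((\<lambda>k. mpow z k *\<^sub>C ?a k) has_sum g z *\<^sub>C \<eta>) UNIV" if z: "z \<in> polydisc" for z
  proof -
    let ?x = "\<chi> i. z $ i * cnj (w $ i)"
    have "cmod (z $ i) * cmod (w $ i) < 1" for i
      using z w mult_strict_mono'[of "cmod (z $ i)" 1 "cmod (w $ i)" 1] by (simp add: polydisc_def)
    hence "?x \<in> polydisc" by (simp add: polydisc_def norm_mult)
    from mpow_has_sum[OF this] have "((\<lambda>k. mpow z k * cnj (mpow w k)) has_sum g z) UNIV"
      by (simp add: mpow_def[abs_def] g_def power_mult_distrib prod.distrib inverse_eq_divide)
    from has_sum_bounded_linear[OF bounded_linear_scaleC_left this, of \<eta>]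
    show ?thesis by (simp add: scaleC_scaleC)
  qed
  moreover have "(\<lambda>k. (norm (?a k))\<^sup>2) summable_on UNIV"
    using summable_on_cmult_left[OF mpow_summable(2)[OF w], of "(norm \<eta>)\<^sup>2"]
    by (simp add: power_mult_distrib)
  ultimately have k: "has_coeffs ?k ?a" by (simp add: has_coeffs_def)
  have "cinner f (Abs_hardy ?k) = cinner (heval f w) \<eta>" for f
  proof -
    have "((\<lambda>k. mpow w k *\<^sub>C hcoeff f k) has_sum heval f w) UNIV"
      using hcoeff_works[of f] w by (auto simp: has_coeffs_def)
    from has_sum_bounded_linear[OF bounded_linear_cinner_left this, of \<eta>]
    show ?thesis
      by (simp add: cinner_hardy_def Abs_hardy(2)[OF k] cinner_scaleC_left cinner_scaleC_right infsumI)
  qed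
  thus ?thesis using Abs_hardy(1)[OF k] by blast
qed

lemma has_coeffs_mult:
  assumes f: "has_coeffs f a"
  shows "has_coeffs (\<lambda>z. (z $ i) *\<^sub>C f z) (\<lambda>k. if k i = 0 then 0 else a (k(i := k i - 1)))"
proof -
  let ?b = "\<lambda>k. if k i = 0 then 0 else a (k(i := k i - 1))"
  let ?s = "\<lambda>k :: 'a \<Rightarrow> nat. k(i := Suc (k i))"
  have bij: "bij_betw ?s UNIV {k. k i \<noteq> 0}"
    by (rule bij_betw_byWitness[where f' = "\<lambda>k. k(i := k i - 1)"]) auto
  have mp: "mpow z (?s k) = z $ i * mpow z k" for z :: "complex ^ 'a" and k
  proof -
    have "mpow z (?s k) = (z $ i) ^ Suc (k i) * (\<Prod>j\<in>UNIV - {i}. (z $ j) ^ k j)"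
      unfolding mpow_def by (subst prod.remove[of _ i]) auto
    moreover have "mpow z k = (z $ i) ^ k i * (\<Prod>j\<in>UNIV - {i}. (z $ j) ^ k j)"
      unfolding mpow_def by (subst prod.remove[of _ i]) auto
    ultimately show ?thesis by (simp add: mult.assoc)
  qed
  have "(\<lambda>k. (norm (?b (?s k)))\<^sup>2) summable_on UNIV"
    using f by (simp add: has_coeffs_def)
  hence "(\<lambda>k. (norm (?b k))\<^sup>2) summable_on {k. k i \<noteq> 0}"
    by (subst (asm) summable_on_reindex_bij_betw[OF bij])
  also have "?this \<longleftrightarrow> (\<lambda>k. (norm (?b k))\<^sup>2) summable_on UNIV"
    by (rule summable_on_cong_neutral) auto
  finally have 1: "(\<lambda>k. (norm (?b k))\<^sup>2) summable_on UNIV" .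
  have 2: "((\<lambda>k. mpow z k *\<^sub>C ?b k) has_sum (z $ i) *\<^sub>C f z) UNIV" if "z \<in> polydisc" for z
  proof -
    have "((\<lambda>k. mpow z k *\<^sub>C a k) has_sum f z) UNIV" using f that by (simp add: has_coeffs_def)
    from has_sum_bounded_linear[OF bounded_linear_scaleC this, of "z $ i"]
    have "((\<lambda>k. mpow z (?s k) *\<^sub>C ?b (?s k)) has_sum (z $ i) *\<^sub>C f z) UNIV"
      by (simp add: mp scaleC_scaleC)
    hence "((\<lambda>k. mpow z k *\<^sub>C ?b k) has_sum (z $ i) *\<^sub>C f z) {k. k i \<noteq> 0}"
      by (subst (asm) has_sum_reindex_bij_betw[OF bij])
    also have "?this \<longleftrightarrow> ?thesis" by (rule has_sum_cong_neutral) auto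
    finally show ?thesis .
  qed
  show ?thesis using 1 2 f by (auto simp: has_coeffs_def)
qed

definition mult_coord :: "'n \<Rightarrow> ('e::chilbert_space, 'n::finite) hardy \<Rightarrow> ('e, 'n) hardy" where
  "mult_coord i f = Abs_hardy (\<lambda>z. (z $ i) *\<^sub>C heval f z)"

lemma mult_coord_works:
  "heval (mult_coord i f) = (\<lambda>z. (z $ i) *\<^sub>C heval f z)"
  "hcoeff (mult_coord i f) = (\<lambda>k. if k i = 0 then 0 else hcoeff f (k(i := k i - 1)))"
  using Abs_hardy[OF has_coeffs_mult[OF hcoeff_works], of i f] by (simp_all add: mult_coord_def)

section \<open>Submodules\<close>

definition csubspace :: "'h::chilbert_space set \<Rightarrow> bool" where
  "csubspace S \<longleftrightarrow> 0 \<in> S \<and> (\<forall>f\<in>S. \<forall>g\<in>S. f + g \<in> S) \<and> (\<forall>c. \<forall>f\<in>S. c *\<^sub>C f \<in> S)"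

definition submodule :: "('e::chilbert_space, 'n::finite) hardy set \<Rightarrow> bool" where
  "submodule S \<longleftrightarrow> csubspace S \<and> closed S \<and> (\<forall>i. \<forall>f\<in>S. mult_coord i f \<in> S)"

definition Rz :: "('e::chilbert_space, 'n::finite) hardy set \<Rightarrow> 'n \<Rightarrow> ('e, 'n) hardy \<Rightarrow> ('e, 'n) hardy" where
  "Rz S i = restrict (mult_coord i) S"

text \<open>The Hilbert space adjoint of a bounded operator \<open>T\<close> on a closed subspace \<open>S\<close>, taken in
  \<open>\<B>(S)\<close>; for \<open>g \<in> S\<close> the vector \<open>u\<close> exists and is unique by the Riesz representation theorem.\<close>

definition adjoint_on :: "'h::chilbert_space set \<Rightarrow> ('h \<Rightarrow> 'h) \<Rightarrow> 'h \<Rightarrow> 'h" where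
  "adjoint_on S T g = (THE u. u \<in> S \<and> (\<forall>f\<in>S. cinner (T f) g = cinner f u))"

definition Rz_adj :: "('e::chilbert_space, 'n::finite) hardy set \<Rightarrow> 'n \<Rightarrow> ('e, 'n) hardy \<Rightarrow> ('e, 'n) hardy" where
  "Rz_adj S i = adjoint_on S (Rz S i)"

text \<open>The operator \<open>T\<^sub>1^k\<^sub>1 \<circ> \<dots> \<circ> T\<^sub>n^k\<^sub>n\<close>. The linear order on the index type plays the role of the order
  of \<open>1, \<dots>, n\<close> and fixes the order of the factors.\<close>

definition op_mpow :: "('n::{finite, linorder} \<Rightarrow> 'h \<Rightarrow> 'h) \<Rightarrow> ('n \<Rightarrow> nat) \<Rightarrow> 'h \<Rightarrow> 'h" where
  "op_mpow T k = foldr (\<lambda>i A. (T i ^^ k i) \<circ> A) (sorted_list_of_set UNIV) id"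

text \<open>The coefficients in this expansion of \<open>1 / g(z, w)\<close> are those of the operator polynomial
  \<open>g_inv_op\<close>.\<close>

lemma g_inv_expansion:
  fixes z w :: "complex ^ 'n::finite"
  shows "(\<Prod>i\<in>UNIV. 1 - z $ i * cnj (w $ i))
    = (\<Sum>k | \<forall>i. k i \<in> {0, 1}. (-1) ^ (\<Sum>i\<in>UNIV. k i) * (mpow z k * cnj (mpow w k)))"
proof -
  have "(\<Prod>i\<in>UNIV. 1 - z $ i * cnj (w $ i)) = (\<Prod>i\<in>UNIV. \<Sum>j\<in>{0, 1::nat}. (- (z $ i * cnj (w $ i))) ^ j)"
    by simp
  also have "\<dots> = (\<Sum>k\<in>PiE UNIV (\<lambda>_. {0, 1}). \<Prod>i\<in>UNIV. (- (z $ i * cnj (w $ i))) ^ k i)"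
    by (rule prod_sum_PiE) auto
  also have "PiE UNIV (\<lambda>_. {0, 1}) = {k :: 'n \<Rightarrow> nat. \<forall>i. k i \<in> {0, 1}}"
    by (auto simp: PiE_UNIV_domain Pi_iff) (metis neq0_conv)
  finally have 1: "(\<Prod>i\<in>UNIV. 1 - z $ i * cnj (w $ i)) = (\<Sum>k | \<forall>i. k i \<in> {0, 1}. \<Prod>i\<in>UNIV. (- (z $ i * cnj (w $ i))) ^ k i)" .
  have 2: "(\<Prod>i\<in>UNIV. (- (z $ i * cnj (w $ i))) ^ k i)
      = (-1) ^ (\<Sum>i\<in>UNIV. k i) * (mpow z k * cnj (mpow w k))" for k
    unfolding mpow_def power_sum cnj_prod prod.distrib[symmetric]
    by (rule prod.cong) (simp_all add: power_minus[of "z $ i * cnj (w $ i)" for i] power_mult_distrib)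
  show ?thesis unfolding 1 2 ..
qed

definition g_inv_op :: "('e::chilbert_space, 'n::{finite, linorder}) hardy set \<Rightarrow> ('e, 'n) hardy \<Rightarrow> ('e, 'n) hardy" where
  "g_inv_op S f = (\<Sum>k | \<forall>i. k i \<in> {0, 1}.
     (-1) ^ (\<Sum>i\<in>UNIV. k i) *\<^sub>C op_mpow (Rz S) k (op_mpow (Rz_adj S) k f))"

definition brehmer_submodule :: "('e::chilbert_space, 'n::{finite, linorder}) hardy set \<Rightarrow> bool" where
  "brehmer_submodule S \<longleftrightarrow> submodule S \<and> (\<forall>f\<in>S. cinner (g_inv_op S f) f \<in> \<real>\<^sub>\<ge>\<^sub>0)"

definition doubly_commuting_submodule :: "('e::chilbert_space, 'n::finite) hardy set \<Rightarrow> bool" where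
  "doubly_commuting_submodule S \<longleftrightarrow> submodule S \<and>
     (\<forall>i j. i \<noteq> j \<longrightarrow> (\<forall>f\<in>S. Rz_adj S i (Rz S j f) - Rz S j (Rz_adj S i f) = 0))"

end

theory Submission
  imports Defs
begin

text \<open>Brehmer positivity says that \<open>\<Sum> (-1)^|F| \<parallel>R\<^sub>F\<^sup>* f\<parallel>\<^sup>2 \<ge> 0\<close>, summed over all sets \<open>F\<close> of coordinates.
  The form for \<open>F \<union> {x}\<close> at \<open>f\<close> is the form for \<open>F\<close> at \<open>f\<close> minus the one at \<open>R\<^sub>x\<^sup>* f\<close>. Since the
  powers of \<open>R\<^sub>x\<^sup>*\<close> tend strongly to \<open>0\<close>, nonnegativity therefore passes to subsets of the coordinates,
  in particular to each pair \<open>{i, j}\<close>. Evaluating the form of a pair at \<open>R\<^sub>i h\<close> gives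
  \<open>\<parallel>q\<parallel> \<le> \<parallel>R\<^sub>i\<^sup>* q\<parallel>\<close> for \<open>q = R\<^sub>j\<^sup>* R\<^sub>i h\<close>, so \<open>q\<close> lies in the range of \<open>R\<^sub>i\<close>, that is
  \<open>q = R\<^sub>i R\<^sub>i\<^sup>* q = R\<^sub>i R\<^sub>j\<^sup>* h\<close>. Conversely, for doubly commuting isometries the operator is a product
  of commuting projections.\<close>

section \<open>Projections and adjoints on closed subspaces\<close>

lemma cinner_minus_left: "cinner (- x) y = - cinner x (y :: 'a::chilbert_space)"
  using cinner_scaleC_left[of "-1" x y] by (simp add: scaleC_minus_one)

lemma cinner_minus_right: "cinner x (- y) = - cinner x (y :: 'a::chilbert_space)"
  using cinner_scaleC_right[of x "-1" y] by (simp add: scaleC_minus_one)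

lemma cinner_diff_left: "cinner (x - y) z = cinner x z - cinner y (z :: 'a::chilbert_space)"
  using cinner_add_left[of x "- y" z] by (simp add: cinner_minus_left)

lemma cinner_diff_right: "cinner x (y - z) = cinner x y - cinner x (z :: 'a::chilbert_space)"
  using cinner_add_right[of x y "- z"] by (simp add: cinner_minus_right)

lemma norm_sq_eq_Re_cinner: "(norm (x :: 'a::chilbert_space))\<^sup>2 = Re (cinner x x)"
  by (simp add: cinner_self)

lemma parallelogram:
  fixes x y :: "'a::chilbert_space"
  shows "(norm (x + y))\<^sup>2 + (norm (x - y))\<^sup>2 = 2 * (norm x)\<^sup>2 + 2 * (norm y)\<^sup>2"
  by (simp add: norm_sq_eq_Re_cinner cinner_add_left cinner_add_right cinner_diff_left cinner_diff_right)

lemma csubspace_uminus: "csubspace S \<Longrightarrow> f \<in> S \<Longrightarrow> - f \<in> S"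
  unfolding csubspace_def by (metis scaleC_minus_one)

lemma csubspace_diff: "csubspace S \<Longrightarrow> f \<in> S \<Longrightarrow> g \<in> S \<Longrightarrow> f - g \<in> S"
  using csubspace_uminus[of S g] unfolding csubspace_def by (metis add_uminus_conv_diff)

lemma csubspace_eqI:
  assumes "csubspace S" "x \<in> S" "y \<in> S" "\<And>g. g \<in> S \<Longrightarrow> cinner x g = cinner y g"
  shows "x = y"
proof -
  have "cinner (x - y) (x - y) = 0"
    using assms csubspace_diff[OF assms(1-3)] by (simp add: cinner_diff_left)
  thus ?thesis by (simp add: cinner_self)
qed

text \<open>The sets of near-minimisers of the distance to \<open>g\<close> are closed, nested and,
  by the parallelogram law, of diameter tending to 0; completeness gives a common point
  \<open>u\<close>, and minimality forces orthogonality.\<close>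

lemma orthogonal_projection:
  fixes M :: "'h::chilbert_space set"
  assumes M: "csubspace M" "closed M"
  obtains u where "u \<in> M" "\<And>f. f \<in> M \<Longrightarrow> cinner f (g - u) = 0"
proof -
  define \<delta> where "\<delta> = (INF u\<in>M. (norm (g - u))\<^sup>2)"
  have ne: "M \<noteq> {}" using M by (auto simp: csubspace_def)
  have le: "\<delta> \<le> (norm (g - u))\<^sup>2" if "u \<in> M" for u
    unfolding \<delta>_def by (rule cINF_lower[OF _ that]) (auto intro!: bdd_belowI2[where m = 0])
  define C where "C n = {u \<in> M. (norm (g - u))\<^sup>2 \<le> \<delta> + 1 / real (Suc n)}" for n
  obtain u where u: "\<And>n. u \<in> C n"
  proof (rule decreasing_closed_nest[of C])
    show "closed (C n)" for n
    proof -
      have "closed {u. (norm (g - u))\<^sup>2 \<le> \<delta> + 1 / real (Suc n)}"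
        by (intro closed_Collect_le continuous_intros)
      thus ?thesis using closed_Int[OF M(2)] by (simp add: C_def Collect_conj_eq)
    qed
    show "C n \<noteq> {}" for n
    proof -
      have "\<delta> < \<delta> + 1 / real (Suc n)" by simp
      then obtain u where "u \<in> M" "(norm (g - u))\<^sup>2 < \<delta> + 1 / real (Suc n)"
        unfolding \<delta>_def using cInf_lessD[of "(\<lambda>u. (norm (g - u))\<^sup>2) ` M"] ne by blast
      thus ?thesis by (auto simp: C_def intro: less_imp_le)
    qed
    show "C n \<subseteq> C m" if "m \<le> n" for m n
    proof -
      have "1 / real (Suc n) \<le> 1 / real (Suc m)" using that by (simp add: frac_le)
      thus ?thesis by (fastforce simp: C_def)
    qed
    fix e :: real assume "0 < e"
    then obtain n where n: "1 / real (Suc n) < e\<^sup>2 / 4"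
      using nat_approx_posE[of "e\<^sup>2 / 4"] by auto
    have "dist x y < e" if xy: "x \<in> C n" "y \<in> C n" for x y
    proof -
      have "(1/2) *\<^sub>R (x + y) \<in> M"
        using xy M(1) by (auto simp: C_def csubspace_def simp flip: scaleC_of_real)
      hence "4 * \<delta> \<le> (norm (2 *\<^sub>R (g - (1/2) *\<^sub>R (x + y))))\<^sup>2" using le by (fastforce simp: power_mult_distrib)
      also have "2 *\<^sub>R (g - (1/2) *\<^sub>R (x + y)) = (g - x) + (g - y)"
        by (simp add: algebra_simps scaleR_2)
      finally have "4 * \<delta> + (norm ((g - x) - (g - y)))\<^sup>2 \<le> 2 * (norm (g - x))\<^sup>2 + 2 * (norm (g - y))\<^sup>2"
        using parallelogram[of "g - x" "g - y"] by linarith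
      hence "(norm (y - x))\<^sup>2 \<le> 4 * (1 / real (Suc n))" using xy by (simp add: C_def)
      hence "(norm (y - x))\<^sup>2 < e\<^sup>2" using n by linarith
      thus ?thesis using \<open>0 < e\<close> by (simp add: dist_norm norm_minus_commute power2_less_imp_less)
    qed
    thus "\<exists>n. \<forall>x\<in>C n. \<forall>y\<in>C n. dist x y < e" by blast
  qed blast
  have uM: "u \<in> M" using u by (simp add: C_def)
  have "(norm (g - u))\<^sup>2 \<le> \<delta>"
  proof (rule field_le_epsilon)
    fix e :: real assume "0 < e"
    then obtain n where "1 / real (Suc n) < e" using nat_approx_posE by blast
    thus "(norm (g - u))\<^sup>2 \<le> \<delta> + e" using u[of n] by (simp add: C_def)
  qed
  have "cinner f (g - u) = 0" if f: "f \<in> M" for f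
  proof (cases "f = 0")
    case False
    define q where "q = g - u"
    \<comment> \<open>With this coefficient \<open>t *\<^sub>C f\<close> is the projection of
      \<open>q\<close> onto the line of \<open>f\<close>, so minimality of \<open>u\<close> excludes
      a nonzero inner product.\<close>
    define t where "t = cinner q f / cinner f f"
    have ff: "cinner f f \<noteq> 0" using False by (simp add: cinner_self)
    have "u + t *\<^sub>C f \<in> M" using uM f M(1) by (simp add: csubspace_def)
    hence "(norm q)\<^sup>2 \<le> (norm (q - t *\<^sub>C f))\<^sup>2"
      using le[of "u + t *\<^sub>C f"] \<open>(norm (g - u))\<^sup>2 \<le> \<delta>\<close> unfolding q_def diff_diff_eq by linarith
    moreover have "cinner (q - t *\<^sub>C f) (q - t *\<^sub>C f) = cinner q q - t * cinner f q"
    proof -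
      have "cinner (q - t *\<^sub>C f) f = 0"
        using ff by (simp add: cinner_diff_left cinner_scaleC_left t_def)
      hence "cinner (q - t *\<^sub>C f) (q - t *\<^sub>C f) = cinner (q - t *\<^sub>C f) q"
        by (simp add: cinner_diff_right cinner_scaleC_right)
      thus ?thesis by (simp add: cinner_diff_left cinner_scaleC_left)
    qed
    moreover have "t * cinner f q = of_real ((cmod (cinner f q) / norm f)\<^sup>2)"
      by (subst t_def, subst cinner_commute[of q f])
        (simp add: cinner_self power_divide complex_norm_square mult.commute del: of_real_power)
    ultimately have "(cmod (cinner f q) / norm f)\<^sup>2 \<le> 0"
      by (simp add: norm_sq_eq_Re_cinner del: of_real_power)
    thus ?thesis using False by (simp add: q_def)
  qed simp
  thus ?thesis using that uM by blast
qed

lemma adjoint_on_eqI: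
  assumes "csubspace S" "u \<in> S" "\<And>f. f \<in> S \<Longrightarrow> cinner (T f) g = cinner f u"
  shows "adjoint_on S T g = u"
  unfolding adjoint_on_def
proof (rule the_equality)
  fix v assume v: "v \<in> S \<and> (\<forall>f\<in>S. cinner (T f) g = cinner f v)"
  show "v = u"
  proof (rule csubspace_eqI[OF assms(1)])
    fix f assume "f \<in> S"
    hence "cinner f v = cinner f u" using v assms(3) by metis
    thus "cinner v f = cinner u f" by (metis cinner_commute)
  qed (use v assms in auto)
qed (use assms in auto)

text \<open>For an isometry the adjoint is found by projecting onto the (closed) range, so the
  representation theorem for general functionals is not needed.\<close>

lemma isometry_adjoint_on:
  fixes T :: "'h::chilbert_space \<Rightarrow> 'h"
  assumes S: "csubspace S" "closed S"
    and T: "\<And>f g. T (f + g) = T f + T g" "\<And>c f. T (c *\<^sub>C f) = c *\<^sub>C T f"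
      "\<And>f g. cinner (T f) (T g) = cinner f g"
    and g: "g \<in> S"
  shows "adjoint_on S T g \<in> S" "\<And>f. f \<in> S \<Longrightarrow> cinner (T f) g = cinner f (adjoint_on S T g)"
proof -
  have T0: "T 0 = 0" using T(2)[of 0 0] by simp
  have nT: "norm (T f) = norm f" for f
    using T(3)[of f f] by (simp add: cinner_self flip: of_real_power)
  have blT: "bounded_linear T"
    by (rule bounded_linear_intro[where K = 1]) (auto simp: T(1) nT T(2) simp flip: scaleC_of_real)
  have subS: "subspace S"
    using S(1) unfolding csubspace_def subspace_def by (metis scaleC_of_real)
  have "csubspace (T ` S)"
    using S(1) unfolding csubspace_def by (auto simp flip: T) (use T0 in force)
  moreover have "complete (T ` S)"
    by (rule complete_isometric_image[OF zero_less_one subS blT])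
      (use S(2) nT in \<open>auto simp: complete_eq_closed\<close>)
  hence "closed (T ` S)" by (rule complete_imp_closed)
  ultimately obtain w where "w \<in> T ` S" "\<And>f. f \<in> T ` S \<Longrightarrow> cinner f (g - w) = 0"
    by (rule orthogonal_projection[of "T ` S" g]) blast
  then obtain u where u: "u \<in> S" "\<And>f. f \<in> S \<Longrightarrow> cinner (T f) (g - T u) = 0" by auto
  have *: "cinner (T f) g = cinner f u" if "f \<in> S" for f
    using u(2)[OF that] T(3)[of f u] by (simp add: cinner_diff_right)
  have "adjoint_on S T g = u" by (rule adjoint_on_eqI) (use S u * in auto)
  thus "adjoint_on S T g \<in> S" "\<And>f. f \<in> S \<Longrightarrow> cinner (T f) g = cinner f (adjoint_on S T g)"
    using u * by auto
qed

section \<open>Commuting isometries\<close>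

text \<open>These folds are \<open>op_mpow\<close> over an arbitrary list of indices, which makes
  induction on the list possible.\<close>

lemma foldr_compose_in:
  assumes "\<And>i g. g \<in> S \<Longrightarrow> T i g \<in> S" "f \<in> S"
  shows "foldr (\<lambda>i A. (T i ^^ k i) \<circ> A) xs id f \<in> S"
proof -
  have "(T i ^^ m) g \<in> S" if "g \<in> S" for i m g
    using that by (induction m) (auto intro: assms)
  thus ?thesis using assms(2) by (induction xs) auto
qed

lemma foldr_compose_cong:
  assumes "\<And>i. i \<in> set xs \<Longrightarrow> k i = l i"
  shows "foldr (\<lambda>i A. (T i ^^ k i) \<circ> A) xs id = foldr (\<lambda>i A. (T i ^^ l i) \<circ> A) xs id"
  using assms by (induction xs) auto

text \<open>Multi-indices on \<open>A\<close> are encoded as total functions vanishing off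
  \<open>A\<close>; the new index \<open>x\<close> splits them by \<open>k x = 0\<close> or
  \<open>k x = 1\<close>.\<close>

lemma multiindex01_insert:
  assumes "x \<notin> A"
  shows "{k :: 'i \<Rightarrow> nat. (\<forall>i\<in>insert x A. k i \<in> {0, 1}) \<and> (\<forall>i. i \<notin> insert x A \<longrightarrow> k i = 0)}
    = {k. (\<forall>i\<in>A. k i \<in> {0, 1}) \<and> (\<forall>i. i \<notin> A \<longrightarrow> k i = 0)}
      \<union> (\<lambda>k. k(x := 1)) ` {k. (\<forall>i\<in>A. k i \<in> {0, 1}) \<and> (\<forall>i. i \<notin> A \<longrightarrow> k i = 0)}"
    (is "?L = ?K \<union> ?f ` ?K")
proof
  show "?L \<subseteq> ?K \<union> ?f ` ?K"
  proof
    fix k assume k: "k \<in> ?L"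
    show "k \<in> ?K \<union> ?f ` ?K"
    proof (cases "k x = 0")
      case True
      have "k i = 0" if "i \<notin> A" for i using k True that by (cases "i = x") auto
      thus ?thesis using k by auto
    next
      case False
      hence "k = ?f (k(x := 0))" using k by auto
      moreover have "k(x := 0) \<in> ?K" using k assms by auto
      ultimately show ?thesis by blast
    qed
  qed
  show "?K \<union> ?f ` ?K \<subseteq> ?L" by auto blast+
qed

text \<open>\<open>V\<close> and \<open>W\<close> stand for \<open>Rz S\<close> and
  \<open>Rz_adj S\<close>. Conditions are imposed only on \<open>S\<close>, since
  \<open>Rz S i\<close> is \<open>undefined\<close> elsewhere.\<close>

locale commuting_isometries =
  fixes S :: "'h::chilbert_space set" and V W :: "'i \<Rightarrow> 'h \<Rightarrow> 'h"
  assumes S: "csubspace S"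
    and V_in: "f \<in> S \<Longrightarrow> V i f \<in> S"
    and W_in: "f \<in> S \<Longrightarrow> W i f \<in> S"
    and adj: "f \<in> S \<Longrightarrow> g \<in> S \<Longrightarrow> cinner (V i f) g = cinner f (W i g)"
    and iso: "f \<in> S \<Longrightarrow> g \<in> S \<Longrightarrow> cinner (V i f) (V i g) = cinner f g"
    and V_comm: "f \<in> S \<Longrightarrow> V i (V j f) = V j (V i f)"
begin

lemma S_diff: "f \<in> S \<Longrightarrow> g \<in> S \<Longrightarrow> f - g \<in> S"
  by (rule csubspace_diff[OF S])

lemma S_scaleC: "f \<in> S \<Longrightarrow> c *\<^sub>C f \<in> S" and S_add: "f \<in> S \<Longrightarrow> g \<in> S \<Longrightarrow> f + g \<in> S"
  and S_zero: "0 \<in> S"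
  using S by (auto simp: csubspace_def)

lemma adj': "f \<in> S \<Longrightarrow> g \<in> S \<Longrightarrow> cinner (W i f) g = cinner f (V i g)"
  using adj[of g f i] cinner_commute by metis

text \<open>Here and in the next lemmas, equality in \<open>S\<close> is tested by inner products
  with elements of \<open>S\<close>, moving \<open>V\<close> and \<open>W\<close> across; even
  linearity comes from the adjoint relation.\<close>

lemma W_V: "f \<in> S \<Longrightarrow> W i (V i f) = f"
  by (rule csubspace_eqI[OF S]) (simp_all add: V_in W_in adj' iso)

lemma W_comm: "f \<in> S \<Longrightarrow> W i (W j f) = W j (W i f)"
  by (rule csubspace_eqI[OF S]) (simp_all add: V_in W_in adj' V_comm)

lemma W_diff: "f \<in> S \<Longrightarrow> g \<in> S \<Longrightarrow> W i (f - g) = W i f - W i g"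
  by (rule csubspace_eqI[OF S]) (simp_all add: V_in W_in adj' S_diff cinner_diff_left)

lemma V_add: "f \<in> S \<Longrightarrow> g \<in> S \<Longrightarrow> V i (f + g) = V i f + V i g"
  by (rule csubspace_eqI[OF S]) (simp_all add: V_in W_in adj S_add cinner_add_left)

lemma V_scaleC: "f \<in> S \<Longrightarrow> V i (c *\<^sub>C f) = c *\<^sub>C V i f"
  by (rule csubspace_eqI[OF S]) (simp_all add: V_in W_in adj S_scaleC cinner_scaleC_left)

lemma V_zero: "V i 0 = 0"
  using V_scaleC[OF S_zero, of i 0] by simp

lemma sum_in_S: "(\<And>k. k \<in> K \<Longrightarrow> u k \<in> S) \<Longrightarrow> (\<Sum>k\<in>K. u k) \<in> S"
  by (induction K rule: infinite_finite_induct) (simp_all add: S_add S_zero)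

lemma V_sum: "(\<And>k. k \<in> K \<Longrightarrow> u k \<in> S) \<Longrightarrow> V i (\<Sum>k\<in>K. u k) = (\<Sum>k\<in>K. V i (u k))"
proof (induction K rule: infinite_finite_induct)
  case (insert k K)
  have "(\<Sum>k\<in>K. u k) \<in> S" using insert.prems by (intro sum_in_S) auto
  thus ?case using insert by (simp add: V_add)
qed (simp_all add: V_zero)

lemma norm_V: "f \<in> S \<Longrightarrow> norm (V i f) = norm f"
  using iso[of f f i] by (simp add: cinner_self flip: of_real_power)

text \<open>Since \<open>W i\<close> is a left inverse of \<open>V i\<close>,
  \<open>V i (W i f)\<close> is the orthogonal projection of \<open>f\<close> onto the range of
  \<open>V i\<close>; this is Pythagoras.\<close>

lemma norm_defect:
  assumes "f \<in> S"
  shows "(norm (f - V i (W i f)))\<^sup>2 = (norm f)\<^sup>2 - (norm (W i f))\<^sup>2"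
proof -
  have "cinner (f - V i (W i f)) (f - V i (W i f)) = cinner f f - cinner (W i f) (W i f)"
    using assms by (simp add: cinner_diff_left cinner_diff_right adj V_in W_in W_V flip: adj')
  thus ?thesis by (simp add: norm_sq_eq_Re_cinner)
qed

lemma norm_W_le: "f \<in> S \<Longrightarrow> norm (W i f) \<le> norm f"
  using norm_defect[of f i] by (metis diff_ge_0_iff_ge norm_ge_zero power2_le_imp_le zero_le_power2)

lemma W_funpow_in: "f \<in> S \<Longrightarrow> (W i ^^ m) f \<in> S" and V_funpow_in: "f \<in> S \<Longrightarrow> (V i ^^ m) f \<in> S"
  by (induction m) (auto simp: W_in V_in)

lemma funpow_adj: "f \<in> S \<Longrightarrow> g \<in> S \<Longrightarrow> cinner ((V i ^^ m) f) g = cinner f ((W i ^^ m) g)"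
  by (induction m arbitrary: g) (simp_all add: adj W_in V_funpow_in funpow_swap1[of "W i"])

lemma norm_V_funpow: "f \<in> S \<Longrightarrow> norm ((V i ^^ m) f) = norm f"
  by (induction m) (simp_all add: norm_V V_funpow_in)

text \<open>The operator \<open>\<Sum> (-1)^|F| V\<^sub>F W\<^sub>F\<close> over the subsets \<open>F\<close> of a list of indices.\<close>

primrec brehmer_op :: "'i list \<Rightarrow> 'h \<Rightarrow> 'h" where
  "brehmer_op [] f = f"
| "brehmer_op (x # xs) f = brehmer_op xs f - V x (brehmer_op xs (W x f))"

lemma brehmer_op_in: "f \<in> S \<Longrightarrow> brehmer_op xs f \<in> S"
  by (induction xs arbitrary: f) (simp_all add: S_diff V_in W_in)

text \<open>In the fold over \<open>x # xs\<close> the factor \<open>W x\<close> acts last, whereas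
  \<open>brehmer_op\<close> applies it first; commutativity reconciles the two orders.\<close>

lemma foldr_W_W:
  assumes "f \<in> S"
  shows "foldr (\<lambda>i A. (W i ^^ k i) \<circ> A) xs id (W x f) = W x (foldr (\<lambda>i A. (W i ^^ k i) \<circ> A) xs id f)"
proof -
  have *: "(W i ^^ m) (W x g) = W x ((W i ^^ m) g)" if "g \<in> S" for i m g
    using that by (induction m) (simp_all add: W_comm W_funpow_in)
  show ?thesis using foldr_compose_in[of S W, OF W_in assms] by (induction xs) (simp_all add: *)
qed

text \<open>Induction on the list: the indices with \<open>k x = 0\<close> sum to
  \<open>brehmer_op xs f\<close>, those with \<open>k x = 1\<close> to
  \<open>- V x (brehmer_op xs (W x f))\<close>. Finiteness is carried along to split the
  sum.\<close>

lemma brehmer_op_expansion: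
  assumes "distinct xs" "f \<in> S"
  shows "(\<Sum>k | (\<forall>i\<in>set xs. k i \<in> {0, 1}) \<and> (\<forall>i. i \<notin> set xs \<longrightarrow> k i = 0).
      (-1) ^ (\<Sum>i\<in>set xs. k i) *\<^sub>C foldr (\<lambda>i A. (V i ^^ k i) \<circ> A) xs id
        (foldr (\<lambda>i A. (W i ^^ k i) \<circ> A) xs id f)) = brehmer_op xs f
    \<and> finite {k :: 'i \<Rightarrow> nat. (\<forall>i\<in>set xs. k i \<in> {0, 1}) \<and> (\<forall>i. i \<notin> set xs \<longrightarrow> k i = 0)}"
  using assms
proof (induction xs arbitrary: f)
  case Nil
  have "{k :: 'i \<Rightarrow> nat. \<forall>i. k i = 0} = {\<lambda>_. 0}" by auto
  thus ?case by simp
next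
  case (Cons x xs)
  define K where "K = {k :: 'i \<Rightarrow> nat. (\<forall>i\<in>set xs. k i \<in> {0, 1}) \<and> (\<forall>i. i \<notin> set xs \<longrightarrow> k i = 0)}"
  \<comment> \<open>The vector is a parameter of \<open>u\<close> because the induction hypothesis
    is needed at \<open>f\<close> and at \<open>W x f\<close>.\<close>
  define u where "u k f = (-1) ^ (\<Sum>i\<in>set xs. k i) *\<^sub>C foldr (\<lambda>i A. (V i ^^ k i) \<circ> A) xs id
        (foldr (\<lambda>i A. (W i ^^ k i) \<circ> A) xs id f)" for k f
  define u' where "u' k = (-1) ^ (\<Sum>i\<in>set (x # xs). k i) *\<^sub>C foldr (\<lambda>i A. (V i ^^ k i) \<circ> A) (x # xs) id
        (foldr (\<lambda>i A. (W i ^^ k i) \<circ> A) (x # xs) id f)" for k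
  have x: "x \<notin> set xs" and f: "f \<in> S" using Cons.prems by auto
  have "distinct xs" using Cons.prems by simp
  hence IH: "(\<Sum>k\<in>K. u k g) = brehmer_op xs g \<and> finite K" if "g \<in> S" for g
    using Cons.IH[of g] that unfolding K_def u_def by blast
  have u_in: "u k g \<in> S" if "g \<in> S" for k g
    unfolding u_def by (intro S_scaleC foldr_compose_in V_in W_in that)
  have K0: "k x = 0" if "k \<in> K" for k using that x by (simp add: K_def)
  have inj: "inj_on (\<lambda>k. k(x := 1)) K"
  proof (rule inj_onI)
    fix k l assume kl: "k \<in> K" "l \<in> K" "k(x := 1) = l(x := 1)"
    have "k i = l i" for i
      using fun_cong[OF kl(3), of i] K0[OF kl(1)] K0[OF kl(2)] by (cases "i = x") auto
    thus "k = l" by blast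
  qed
  have u'0: "u' k = u k f" if "k \<in> K" for k
    using K0[OF that] x by (simp add: u_def u'_def)
  have u'1: "u' (k(x := 1)) = - V x (u k (W x f))" if "k \<in> K" for k
  proof -
    have c: "foldr (\<lambda>i A. (T i ^^ (k(x := 1)) i) \<circ> A) xs id = foldr (\<lambda>i A. (T i ^^ k i) \<circ> A) xs id"
      for T :: "'i \<Rightarrow> 'h \<Rightarrow> 'h"
      using x by (intro foldr_compose_cong) auto
    have s: "(\<Sum>i\<in>set xs. (k(x := 1)) i) = (\<Sum>i\<in>set xs. k i)"
      using x by (intro sum.cong) auto
    have in_S: "foldr (\<lambda>i A. (V i ^^ k i) \<circ> A) xs id
        (foldr (\<lambda>i A. (W i ^^ k i) \<circ> A) xs id (W x f)) \<in> S"
      by (intro foldr_compose_in V_in W_in f)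
    have "u' (k(x := 1)) = ((-1) * (-1) ^ (\<Sum>i\<in>set xs. k i)) *\<^sub>C
        V x (foldr (\<lambda>i A. (V i ^^ k i) \<circ> A) xs id (W x (foldr (\<lambda>i A. (W i ^^ k i) \<circ> A) xs id f)))"
      using x unfolding u'_def by (simp add: c s fun_upd_same del: fun_upd_apply One_nat_def) simp
    also have "\<dots> = (-1) *\<^sub>C V x (u k (W x f))"
      unfolding u_def V_scaleC[OF in_S] by (simp add: foldr_W_W[OF f] scaleC_scaleC)
    finally show ?thesis by (simp add: scaleC_minus_one)
  qed
  have "(\<Sum>k\<in>K \<union> (\<lambda>k. k(x := 1)) ` K. u' k) = (\<Sum>k\<in>K. u' k) + (\<Sum>k\<in>K. u' (k(x := 1)))"
  proof -
    have "K \<inter> (\<lambda>k. k(x := 1)) ` K = {}" using K0 by force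
    thus ?thesis using IH[OF f] by (simp add: sum.union_disjoint sum.reindex[OF inj] o_def del: One_nat_def)
  qed
  also have "\<dots> = (\<Sum>k\<in>K. u k f) - V x (\<Sum>k\<in>K. u k (W x f))"
    by (simp add: u'0 u'1 sum_negf V_sum u_in W_in f del: One_nat_def)
  also have "\<dots> = brehmer_op (x # xs) f"
    by (simp add: IH f W_in)
  finally have "(\<Sum>k\<in>K \<union> (\<lambda>k. k(x := 1)) ` K. u' k) = brehmer_op (x # xs) f" .
  thus ?case
    using IH[OF f] unfolding list.set multiindex01_insert[OF x, folded K_def] u'_def by blast
qed

section \<open>The quadratic form and its restriction to fewer coordinates\<close>

definition brehmer_form :: "'i list \<Rightarrow> 'h \<Rightarrow> real" where
  "brehmer_form xs f = Re (cinner (brehmer_op xs f) f)"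

lemma brehmer_form_Nil: "brehmer_form [] f = (norm f)\<^sup>2"
  by (simp add: brehmer_form_def norm_sq_eq_Re_cinner)

lemma brehmer_form_Cons:
  "f \<in> S \<Longrightarrow> brehmer_form (x # xs) f = brehmer_form xs f - brehmer_form xs (W x f)"
  by (simp add: brehmer_form_def cinner_diff_left adj brehmer_op_in W_in)

text \<open>The \<open>W i\<close> commute, so any entry can be brought to the front, where
  \<open>brehmer_form_drop\<close> can remove it.\<close>

lemma brehmer_form_middle:
  "f \<in> S \<Longrightarrow> brehmer_form (xs @ x # ys) f = brehmer_form (x # xs @ ys) f"
  by (induction xs arbitrary: f) (simp_all add: brehmer_form_Cons W_in W_comm)

text \<open>Each \<open>W x\<close> is a contraction on \<open>S\<close>, so null sequences stay
  null through the recursion.\<close>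

lemma brehmer_form_tendsto_0:
  assumes "\<And>m. X m \<in> S" "X \<longlonglongrightarrow> 0"
  shows "(\<lambda>m. brehmer_form xs (X m)) \<longlonglongrightarrow> 0"
  using assms
proof (induction xs arbitrary: X)
  case Nil
  thus ?case by (auto simp: brehmer_form_Nil intro!: tendsto_eq_intros)
next
  case (Cons x xs)
  have "(\<lambda>m. W x (X m)) \<longlonglongrightarrow> 0"
    by (rule Lim_null_comparison[OF _ tendsto_norm_zero[OF Cons.prems(2)]])
      (simp add: norm_W_le Cons.prems)
  thus ?case
    using tendsto_diff[OF Cons.IH[OF Cons.prems] Cons.IH[of "\<lambda>m. W x (X m)"]]
    by (simp add: brehmer_form_Cons Cons.prems W_in)
qed

text \<open>Nonnegativity of the longer form says that the shorter one decreases along the orbit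
  \<open>f, W x f, W x (W x f), \<dots>\<close>, whose limit is \<open>0\<close>.\<close>

lemma brehmer_form_drop:
  assumes pos: "\<And>f. f \<in> S \<Longrightarrow> 0 \<le> brehmer_form (x # xs) f"
    and pure: "\<And>f. f \<in> S \<Longrightarrow> (\<lambda>m. (W x ^^ m) f) \<longlonglongrightarrow> 0"
    and f: "f \<in> S"
  shows "0 \<le> brehmer_form xs f"
proof (rule LIMSEQ_le_const2)
  show "(\<lambda>m. brehmer_form xs ((W x ^^ m) f)) \<longlonglongrightarrow> 0"
    by (intro brehmer_form_tendsto_0 W_funpow_in pure f)
  have "brehmer_form xs ((W x ^^ m) f) \<le> brehmer_form xs f" for m
  proof (induction m)
    case (Suc m)
    thus ?case using pos[OF W_funpow_in[OF f, of m x]] by (simp add: brehmer_form_Cons W_funpow_in f)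
  qed simp
  thus "\<exists>N. \<forall>m\<ge>N. brehmer_form xs ((W x ^^ m) f) \<le> brehmer_form xs f" by blast
qed

text \<open>The prefix \<open>ys\<close> collects the entries already kept; each rejected entry is
  moved to the front and dropped.\<close>

lemma brehmer_form_filter:
  assumes "\<And>f. f \<in> S \<Longrightarrow> 0 \<le> brehmer_form (ys @ xs) f"
    and pure: "\<And>x f. f \<in> S \<Longrightarrow> (\<lambda>m. (W x ^^ m) f) \<longlonglongrightarrow> 0"
    and "f \<in> S"
  shows "0 \<le> brehmer_form (ys @ filter Q xs) f"
  using assms(1,3)
proof (induction xs arbitrary: ys f)
  case (Cons x xs)
  show ?case
  proof (cases "Q x")
    case True
    thus ?thesis using Cons.IH[of "ys @ [x]" f] Cons.prems by simp
  next
    case False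
    have "0 \<le> brehmer_form (x # ys @ xs) g" if "g \<in> S" for g
      using Cons.prems(1)[OF that] brehmer_form_middle[OF that] by simp
    hence "0 \<le> brehmer_form (ys @ xs) g" if "g \<in> S" for g
      by (rule brehmer_form_drop[OF _ pure that])
    thus ?thesis using Cons.IH[of ys f] Cons.prems False by simp
  qed
qed simp

lemma brehmer_pair_imp_doubly_commuting:
  assumes pos: "\<And>f. f \<in> S \<Longrightarrow> 0 \<le> brehmer_form [i, j] f" and h: "h \<in> S"
  shows "W j (V i h) = V i (W j h)"
proof -
  let ?q = "W j (V i h)"
  have q: "?q \<in> S" by (intro W_in V_in h)
  have Wq: "W i ?q = W j h" using W_comm[of "V i h" i j] by (simp add: V_in h W_V)
  \<comment> \<open>At \<open>V i h\<close> the terms \<open>(norm (V i h))\<^sup>2\<close> and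
    \<open>(norm (W i (V i h)))\<^sup>2\<close> of the form cancel, which leaves
    \<open>(norm (W j h))\<^sup>2 - (norm ?q)\<^sup>2\<close>.\<close>
  have "(norm ?q)\<^sup>2 \<le> (norm (W i ?q))\<^sup>2"
    using pos[OF V_in[OF h, of i]]
    by (simp add: brehmer_form_Cons brehmer_form_Nil V_in W_in h W_V norm_V Wq)
  hence "(norm (?q - V i (W i ?q)))\<^sup>2 \<le> 0" using norm_defect[OF q, of i] by simp
  thus ?thesis by (simp add: Wq)
qed

lemma brehmer_imp_doubly_commuting:
  assumes pos: "\<And>f. f \<in> S \<Longrightarrow> 0 \<le> brehmer_form xs f"
    and pure: "\<And>x f. f \<in> S \<Longrightarrow> (\<lambda>m. (W x ^^ m) f) \<longlonglongrightarrow> 0"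
    and ij: "i \<in> set xs" "j \<in> set xs" "i \<noteq> j" and "distinct xs" and h: "h \<in> S"
  shows "W j (V i h) = V i (W j h)"
proof (rule brehmer_pair_imp_doubly_commuting[OF _ h])
  fix f assume f: "f \<in> S"
  define ys where "ys = filter (\<lambda>x. x \<in> {i, j}) xs"
  have set_ys: "set ys = {i, j}" and "distinct ys" using ij \<open>distinct xs\<close> by (auto simp: ys_def)
  hence "length ys = 2" using ij(3) distinct_card[of ys] by simp
  then obtain a b where ab: "ys = [a, b]" by (auto simp: length_Suc_conv numeral_2_eq_2)
  have "0 \<le> brehmer_form ys f"
    using brehmer_form_filter[where ys = "[]", OF _ pure f, of xs] pos by (simp add: ys_def)
  \<comment> \<open>Filtering keeps the order of \<open>xs\<close>, so the pair may come out
    reversed; the form is the same for both orders.\<close>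
  moreover have "ys = [i, j] \<or> ys = [j, i]"
    using set_ys unfolding ab by (simp add: doubleton_eq_iff)
  moreover have "brehmer_form [j, i] f = brehmer_form [i, j] f"
    using brehmer_form_middle[OF f, of "[j]" i "[]"] by simp
  ultimately show "0 \<le> brehmer_form [i, j] f" by (elim disjE) simp_all
qed

text \<open>The operator is a product of commuting orthogonal projections
  \<open>I - V x W x\<close>, hence itself an orthogonal projection. The exact value, unlike mere
  nonnegativity, carries through the induction.\<close>

lemma doubly_commuting_imp_brehmer:
  assumes dc: "\<And>i j f. i \<noteq> j \<Longrightarrow> f \<in> S \<Longrightarrow> W i (V j f) = V j (W i f)"
    and "distinct xs" "f \<in> S"
  shows "cinner (brehmer_op xs f) f = of_real ((norm (brehmer_op xs f))\<^sup>2)"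
  using assms(2,3)
proof (induction xs arbitrary: f)
  case (Cons x xs)
  let ?g = "brehmer_op xs f"
  \<comment> \<open>Double commutation enters here: \<open>W x\<close> passes every factor whose
    index differs from \<open>x\<close>.\<close>
  have "brehmer_op ys (W x f) = W x (brehmer_op ys f)" if "x \<notin> set ys" "f \<in> S" for ys f
    using that
  proof (induction ys arbitrary: f)
    case (Cons y ys)
    hence "brehmer_op ys (W y (W x f)) = W x (brehmer_op ys (W y f))"
      using W_comm[of f y x] by (simp add: W_in)
    thus ?case using Cons by (simp add: W_diff V_in W_in brehmer_op_in dc)
  qed simp
  hence Wg: "brehmer_op xs (W x f) = W x ?g" using Cons.prems by simp
  have "cinner (brehmer_op (x # xs) f) f = cinner ?g f - cinner (brehmer_op xs (W x f)) (W x f)"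
    using Cons.prems by (simp add: cinner_diff_left adj brehmer_op_in W_in)
  also have "\<dots> = of_real ((norm ?g)\<^sup>2 - (norm (W x ?g))\<^sup>2)"
      using Cons.IH[of f] Cons.IH[of "W x f"] Cons.prems by (simp add: W_in Wg)
  also have "\<dots> = of_real ((norm (?g - V x (W x ?g)))\<^sup>2)"
    using Cons.prems by (simp add: norm_defect brehmer_op_in)
  finally show ?case by (simp add: Wg)
qed (simp add: cinner_self)

end

section \<open>Coordinate multiplications on the Hardy space\<close>

lemma mult_coord_add: "mult_coord i (f + g) = mult_coord i f + mult_coord i g"
  by (rule hardy_eqI) (simp add: mult_coord_works hardy_works)

lemma mult_coord_scaleC: "mult_coord i (c *\<^sub>C f) = c *\<^sub>C mult_coord i f"
  by (rule hardy_eqI) (simp add: mult_coord_works scaleC_hardy_works)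

lemma mult_coord_commute: "mult_coord i (mult_coord j f) = mult_coord j (mult_coord i f)"
  by (rule hardy_eqI) (auto simp: mult_coord_works fun_upd_twist)

text \<open>Multiplication by the coordinate shifts the coefficients bijectively onto the indices
  with \<open>k i \<noteq> 0\<close> and puts zeros elsewhere.\<close>

lemma cinner_mult_coord: "cinner (mult_coord i f) (mult_coord i g) = cinner f g"
proof -
  have bij: "bij_betw (\<lambda>k. k(i := Suc (k i))) UNIV {k. k i \<noteq> 0}"
    by (rule bij_betw_byWitness[where f' = "\<lambda>k. k(i := k i - 1)"]) auto
  let ?c = "\<lambda>k. cinner (hcoeff (mult_coord i f) k) (hcoeff (mult_coord i g) k)"
  have "(\<Sum>\<^sub>\<infinity>k. ?c k) = (\<Sum>\<^sub>\<infinity>k\<in>{k. k i \<noteq> 0}. ?c k)"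
    by (rule infsum_cong_neutral) (auto simp: mult_coord_works)
  also have "\<dots> = (\<Sum>\<^sub>\<infinity>k. ?c (k(i := Suc (k i))))"
    by (rule infsum_reindex_bij_betw[OF bij, symmetric])
  finally show ?thesis by (simp add: cinner_hardy_def mult_coord_works)
qed

section \<open>Powers of the coordinate multiplications and coefficient tails\<close>

lemma hcoeff_mult_coord_funpow: "k i < m \<Longrightarrow> hcoeff ((mult_coord i ^^ m) f) k = 0"
  by (induction m arbitrary: k) (auto simp: mult_coord_works)

text \<open>A finite \<open>F\<close> carries all but \<open>e / 2\<close> of the sum, and once
  \<open>m\<close> exceeds \<open>d\<close> on \<open>F\<close> only indices outside
  \<open>F\<close> contribute.\<close>

lemma infsum_tail_tendsto_0:
  fixes a :: "'k \<Rightarrow> real" and d :: "'k \<Rightarrow> nat"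
  assumes "a summable_on UNIV" "\<And>k. 0 \<le> a k"
  shows "(\<lambda>m. \<Sum>\<^sub>\<infinity>k. if d k < m then 0 else a k) \<longlonglongrightarrow> 0"
proof (rule LIMSEQ_I)
  fix e :: real assume "0 < e"
  then obtain F where F: "finite F" "dist (sum a F) (\<Sum>\<^sub>\<infinity>k. a k) \<le> e / 2"
    using infsum_finite_approximation[OF assms(1), of "e / 2"] by auto
  have sm: "(\<lambda>k. if d k < m then 0 else a k) summable_on UNIV" for m
    by (rule summable_on_comparison_test[OF assms(1)]) (auto simp: assms)
  have smF: "a summable_on - F" by (rule summable_on_subset_banach[OF assms(1)]) simp
  \<comment> \<open>\<open>insert 0\<close> keeps \<open>Max\<close> meaningful for empty
    \<open>F\<close>.\<close>
  have "norm ((\<Sum>\<^sub>\<infinity>k. if d k < m then 0 else a k) - 0) < e" if "Suc (Max (insert 0 (d ` F))) \<le> m" for m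
  proof -
    have lt: "d k < m" if "k \<in> F" for k
    proof -
      have "d k \<le> Max (insert 0 (d ` F))" using that F(1) by (intro Max_ge) auto
      thus ?thesis using \<open>Suc _ \<le> m\<close> by linarith
    qed
    have "(\<Sum>\<^sub>\<infinity>k. if d k < m then 0 else a k) \<le> (\<Sum>\<^sub>\<infinity>k\<in>-F. a k)"
      by (rule infsum_mono_neutral[OF sm smF]) (auto simp: assms lt)
    also have "\<dots> = (\<Sum>\<^sub>\<infinity>k. a k) - sum a F"
      using infsum_Diff[OF assms(1), of F] F(1) by (simp add: Compl_eq_Diff_UNIV)
    also have "\<dots> \<le> e / 2" using F(2) unfolding dist_real_def by linarith
    finally have "(\<Sum>\<^sub>\<infinity>k. if d k < m then 0 else a k) < e" using \<open>0 < e\<close> by simp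
    moreover have "0 \<le> (\<Sum>\<^sub>\<infinity>k. if d k < m then 0 else a k)" by (rule infsum_nonneg) (simp add: assms)
    ultimately show ?thesis by simp
  qed
  thus "\<exists>M. \<forall>m\<ge>M. norm ((\<Sum>\<^sub>\<infinity>k. if d k < m then 0 else a k) - 0) < e" by blast
qed

text \<open>The left vector has no coefficients with \<open>k i < m\<close>, so \<open>f\<close> may
  be truncated to \<open>t\<close> before applying Cauchy-Schwarz.\<close>

lemma cinner_mult_coord_funpow_le:
  "cmod (cinner ((mult_coord i ^^ m) g) f)
    \<le> norm ((mult_coord i ^^ m) g) * sqrt (\<Sum>\<^sub>\<infinity>k. if k i < m then 0 else (norm (hcoeff f k))\<^sup>2)"
proof -
  let ?t = "\<lambda>k. if k i < m then 0 else hcoeff f k"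
  have "(\<lambda>k. (norm (?t k))\<^sup>2) summable_on UNIV"
    by (rule summable_on_comparison_test[OF hcoeff_summable[of f]]) auto
  then obtain t where t: "hcoeff t = ?t" by (rule hardy_of_coeffs)
  have "cinner ((mult_coord i ^^ m) g) f = cinner ((mult_coord i ^^ m) g) t"
    unfolding cinner_hardy_def t by (rule infsum_cong) (simp add: hcoeff_mult_coord_funpow)
  moreover have "norm t = sqrt (\<Sum>\<^sub>\<infinity>k. if k i < m then 0 else (norm (hcoeff f k))\<^sup>2)"
    unfolding norm_hardy_def t by (intro arg_cong[where f = sqrt] infsum_cong) simp
  ultimately show ?thesis using norm_cinner_le[of "(mult_coord i ^^ m) g" t] by simp
qed

section \<open>Submodules and the equivalence\<close>

lemma submodule_commuting_isometries:
  assumes "submodule S"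
  shows "commuting_isometries S (Rz S) (Rz_adj S)"
proof -
  have S: "csubspace S" "closed S" "\<And>i f. f \<in> S \<Longrightarrow> mult_coord i f \<in> S"
    using assms by (auto simp: submodule_def)
  \<comment> \<open>\<open>adjoint_on\<close> looks at the operator only on \<open>S\<close>, where
    \<open>Rz S i\<close> and \<open>mult_coord i\<close> agree; the latter satisfies the identities
    of \<open>isometry_adjoint_on\<close> for all vectors.\<close>
  have eq: "Rz_adj S i g = adjoint_on S (mult_coord i) g" for i g
    unfolding Rz_adj_def adjoint_on_def Rz_def by (rule arg_cong[where f = The]) auto
  note adj = isometry_adjoint_on[OF S(1,2) mult_coord_add mult_coord_scaleC cinner_mult_coord]
  show ?thesis
    by unfold_locales (use S adj in \<open>auto simp: eq Rz_def cinner_mult_coord mult_coord_commute\<close>)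
qed

text \<open>Pairing the \<open>m\<close>-th iterate \<open>?h\<close> with itself and moving the
  powers across bounds \<open>(norm ?h)\<^sup>2\<close> by \<open>norm ?h\<close> times a
  coefficient tail of \<open>f\<close>, which tends to 0.\<close>

lemma Rz_adj_funpow_tendsto_0:
  assumes "submodule S" "f \<in> S"
  shows "(\<lambda>m. (Rz_adj S i ^^ m) f) \<longlonglongrightarrow> 0"
proof -
  interpret commuting_isometries S "Rz S" "Rz_adj S" by (rule submodule_commuting_isometries) fact
  let ?t = "\<lambda>m. sqrt (\<Sum>\<^sub>\<infinity>k. if k i < m then 0 else (norm (hcoeff f k))\<^sup>2)"
  have Rz_funpow: "(Rz S i ^^ m) g = (mult_coord i ^^ m) g" if "g \<in> S" for m g
  proof (induction m)
    case (Suc m)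
    have "Rz S i h = mult_coord i h" if "h \<in> S" for h using that by (simp add: Rz_def)
    thus ?case using V_funpow_in[OF that, of m i] Suc by simp
  qed simp
  have "norm ((Rz_adj S i ^^ m) f) \<le> ?t m" for m
  proof -
    let ?h = "(Rz_adj S i ^^ m) f"
    have h: "?h \<in> S" by (rule W_funpow_in) fact
    have "(norm ?h)\<^sup>2 = cmod (cinner ?h ?h)" by (simp add: cinner_self norm_power)
    also have "\<dots> = cmod (cinner ((mult_coord i ^^ m) ?h) f)"
      using funpow_adj[OF h assms(2), of m i] by (simp add: Rz_funpow h)
    also have "\<dots> \<le> norm ?h * ?t m"
      using cinner_mult_coord_funpow_le[of m i ?h f] norm_V_funpow[OF h, of m i] by (simp add: Rz_funpow h)
    finally have "norm ?h * norm ?h \<le> norm ?h * ?t m" by (simp add: power2_eq_square)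
    thus ?thesis by (cases "?h = 0") (simp_all add: infsum_nonneg)
  qed
  moreover have "?t \<longlonglongrightarrow> 0"
    using tendsto_real_sqrt[OF infsum_tail_tendsto_0[OF hcoeff_summable[of f], of "\<lambda>k. k i"]] by simp
  ultimately show ?thesis by (rule Lim_null_comparison[OF always_eventually[OF allI]])
qed

theorem theorem7p6:
  fixes S :: "('e::chilbert_space, 'n::{finite, linorder}) hardy set"
  assumes "CARD('n) \<ge> 2"
    and "submodule S"
  shows "brehmer_submodule S \<longleftrightarrow> doubly_commuting_submodule S"
proof -
  interpret commuting_isometries S "Rz S" "Rz_adj S" by (rule submodule_commuting_isometries) fact
  define L where "L = sorted_list_of_set (UNIV :: 'n set)"
  have L: "set L = UNIV" "distinct L" by (simp_all add: L_def)
  \<comment> \<open>For the list \<open>L\<close> of all indices the condition on entries off the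
    list is vacuous, so the expansion is exactly \<open>g_inv_op S f\<close>.\<close>
  have g: "g_inv_op S f = brehmer_op L f" if "f \<in> S" for f
    using brehmer_op_expansion[OF L(2) that] unfolding g_inv_op_def op_mpow_def L_def[symmetric] L(1)
    by simp
  show ?thesis
  proof
    assume "brehmer_submodule S"
    hence pos: "0 \<le> brehmer_form L f" if "f \<in> S" for f
      using that by (simp add: brehmer_submodule_def brehmer_form_def g complex_nonneg_Reals_iff)
    have "Rz_adj S i (Rz S j f) = Rz S j (Rz_adj S i f)" if "i \<noteq> j" "f \<in> S" for i j f
      by (rule brehmer_imp_doubly_commuting[OF pos Rz_adj_funpow_tendsto_0[OF assms(2)]])
        (use that L in auto)
    thus "doubly_commuting_submodule S" using assms(2) by (simp add: doubly_commuting_submodule_def)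
  next
    assume "doubly_commuting_submodule S"
    hence "Rz_adj S i (Rz S j f) = Rz S j (Rz_adj S i f)" if "i \<noteq> j" "f \<in> S" for i j f
      using that by (simp add: doubly_commuting_submodule_def)
    hence "cinner (brehmer_op L f) f = of_real ((norm (brehmer_op L f))\<^sup>2)" if "f \<in> S" for f
      using doubly_commuting_imp_brehmer L(2) that by blast
    thus "brehmer_submodule S"
      using assms(2) by (simp add: brehmer_submodule_def g complex_nonneg_Reals_iff del: of_real_power)
  qed
qed

end
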